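(* Let $B$ be a locally connected metric space and let $X$ be a metric space that is locally compact and locally connected. Let $V$ be a metric space and let $f_t\colon V\to X$ ($t\in B$) be a family of open Lipschitz embeddings giving a Lipschitz isotopy. Let $C$ be a closed subset of $V$ such that the boundary $\partial C$ of $C$ in $V$ is compact and such that $f_t(C)$ is closed in $X$ for all $t\in B$. If $\mathcal{L}^{*}(V-C)$ holds, then for each $b\in B$ there exist a neighborhood $N_b$ of $b$ and a family of Lipschitz isomorphisms $F_t\colon X\to X$ ($t\in N_b$) giving a Lipschitz isotopy such that $F_t\circ f_b=f_t$ near $C$ (on a neighborhood of $C$ in $V$) for every $t\in N_b$. Further, if $C$ is compact, then $F_t\circ f_b=f_b$ away from a compact neighborhood of $C$.
   Context: Lipschitz is a local condition: a map $f\colon X\to Y$ of metric spaces is Lipschitz if every $x\in X$ has an open neighborhood on which $f$ satisfies $d_Y(f(x'),f(x''))\le L_x d_X(x',x'')$ for some constant $L_x$. It is a Lipschitz embedding if it is injective and both $f\colon X\to f(X)$ and $f^{-1}\colon f(X)\to X$ are Lipschitz; a Lipschitz isomorphism is a bijective Lipschitz embedding. An open Lipschitz embedding is a Lipschitz embedding that is an open map. Products carry the sum metric; subsets carry the restricted metric. Lipschitz isotopy: for metric spaces $B,U,Y$, a family $h_t\colon U\to Y$ ($t\in B$) gives a Lipschitz isotopy if the map $B\times U\to B\times Y$, $(t,x)\mapsto(t,h_t(x))$, is an open embedding that is a Lipschitz isomorphism onto its image. $\mathcal{L}^{*}(Y)$, for a metric space $Y$: for every open $U\subseteq Y$ and compact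 $D\subseteq U$ the following holds. For every open Lipschitz embedding $h\colon U\to Y$ sufficiently near the inclusion $i\colon U\to Y$ (in the compact-open topology) there is a Lipschitz isomorphism $h'\colon Y\to Y$ with $h'=h$ on $D$ and $h'$ equal to the identity on $Y-U$; the rule $h\mapsto h'$ is continuous in $h$ for $h$ sufficiently near $i$ and sends $i$ to $\mathrm{id}_Y$; and moreover (P): for every metric space $Z$, if $h_t\colon U\to Y$ ($t\in Z$) gives a Lipschitz isotopy such that the rule $h_t\mapsto h_t'$ is well defined for all $t\in Z$, then $h'_t\colon Y\to Y$ ($t\in Z$) gives a Lipschitz isotopy. In the last sentence of the claim, as in the non-isotopy version of this result, the meaning is that the $F_t$ can be chosen with this additional property; "away from" a set means on its complement in $V$. *)

theory Defs
  imports "HOL-Analysis.Analysis"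
begin

section \<open>Metric spaces with the sum metric\<close>

text \<open>The library's \<^const>\<open>prod_metric\<close> is the Euclidean product metric; here products
  carry the sum metric.\<close>

definition sum_metric :: "'a metric \<Rightarrow> 'b metric \<Rightarrow> ('a \<times> 'b) metric" where
  "sum_metric m1 m2 =
     metric (mspace m1 \<times> mspace m2,
             \<lambda>p q. mdist m1 (fst p) (fst q) + mdist m2 (snd p) (snd q))"

lemma Metric_space_sum_metric:
  "Metric_space (mspace m1 \<times> mspace m2)
     (\<lambda>p q. mdist m1 (fst p) (fst q) + mdist m2 (snd p) (snd q))"
proof (unfold_locales, goal_cases)
  case (1 x y)
  then show ?case by simp
next
  case (2 x y)
  then show ?case by (simp add: mdist_commute)
next
  case (3 x y)
  then show ?case
    by (auto simp: add_nonneg_eq_0_iff prod_eq_iff mem_Times_iff)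
next
  case (4 x y z)
  then have "mdist m1 (fst x) (fst z) \<le> mdist m1 (fst x) (fst y) + mdist m1 (fst y) (fst z)"
    and "mdist m2 (snd x) (snd z) \<le> mdist m2 (snd x) (snd y) + mdist m2 (snd y) (snd z)"
    by (auto intro!: mdist_triangle simp: mem_Times_iff)
  then show ?case by linarith
qed

lemma mspace_sum_metric [simp]: "mspace (sum_metric m1 m2) = mspace m1 \<times> mspace m2"
  unfolding sum_metric_def by (rule Metric_space.mspace_metric[OF Metric_space_sum_metric])

lemma mdist_sum_metric [simp]:
  "mdist (sum_metric m1 m2) =
     (\<lambda>p q. mdist m1 (fst p) (fst q) + mdist m2 (snd p) (snd q))"
  unfolding sum_metric_def by (rule Metric_space.mdist_metric[OF Metric_space_sum_metric])

section \<open>Lipschitz maps, embeddings, isomorphisms and isotopies\<close>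

text \<open>Being Lipschitz is a local condition, unlike \<^const>\<open>Lipschitz_continuous_map\<close>.\<close>

definition lip_map :: "'a metric \<Rightarrow> 'b metric \<Rightarrow> ('a \<Rightarrow> 'b) \<Rightarrow> bool" where
  "lip_map m1 m2 f \<longleftrightarrow>
     f \<in> mspace m1 \<rightarrow> mspace m2 \<and>
     (\<forall>x\<in>mspace m1. \<exists>W. openin (mtopology_of m1) W \<and> x \<in> W \<and>
        Lipschitz_continuous_map (submetric m1 W) m2 f)"

definition lip_embedding :: "'a metric \<Rightarrow> 'b metric \<Rightarrow> ('a \<Rightarrow> 'b) \<Rightarrow> bool" where
  "lip_embedding m1 m2 f \<longleftrightarrow>
     f \<in> mspace m1 \<rightarrow> mspace m2 \<and> inj_on f (mspace m1) \<and>
     lip_map m1 (submetric m2 (f ` mspace m1)) f \<and>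
     lip_map (submetric m2 (f ` mspace m1)) m1 (inv_into (mspace m1) f)"

definition lip_iso :: "'a metric \<Rightarrow> 'b metric \<Rightarrow> ('a \<Rightarrow> 'b) \<Rightarrow> bool" where
  "lip_iso m1 m2 f \<longleftrightarrow> lip_embedding m1 m2 f \<and> bij_betw f (mspace m1) (mspace m2)"

definition open_lip_embedding :: "'a metric \<Rightarrow> 'b metric \<Rightarrow> ('a \<Rightarrow> 'b) \<Rightarrow> bool" where
  "open_lip_embedding m1 m2 f \<longleftrightarrow>
     lip_embedding m1 m2 f \<and> open_map (mtopology_of m1) (mtopology_of m2) f"

definition lip_isotopy ::
  "'t metric \<Rightarrow> 'a metric \<Rightarrow> 'b metric \<Rightarrow> ('t \<Rightarrow> 'a \<Rightarrow> 'b) \<Rightarrow> bool" where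
  "lip_isotopy T m1 m2 h \<longleftrightarrow>
     open_lip_embedding (sum_metric T m1) (sum_metric T m2) (\<lambda>(t, x). (t, h t x))"

section \<open>Spaces of embeddings\<close>

text \<open>Points of function spaces are extensional functions, so that a function on \<open>U\<close> is
  determined by its values on \<open>U\<close>.\<close>

definition compact_open_topology :: "'a topology \<Rightarrow> 'b topology \<Rightarrow> ('a \<Rightarrow> 'b) topology" where
  "compact_open_topology S T = topology_generated_by
     {{f. f \<in> extensional (topspace S) \<and> continuous_map S T f \<and> f ` K \<subseteq> W} | K W.
        compactin S K \<and> openin T W}"

definition open_lip_embedding_space :: "'a metric \<Rightarrow> 'b metric \<Rightarrow> ('a \<Rightarrow> 'b) topology" where
  "open_lip_embedding_space m1 m2 =
     subtopology (compact_open_topology (mtopology_of m1) (mtopology_of m2))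
       {h. h \<in> extensional (mspace m1) \<and> open_lip_embedding m1 m2 h}"

section \<open>The property L*\<close>

text \<open>Here \<open>\<Phi>\<close> is the rule sending \<open>h\<close> to \<open>h'\<close>, and \<open>\<N>\<close>, its domain, is the neighbourhood
  of the inclusion that makes precise ``for \<open>h\<close> sufficiently near \<open>i\<close>''. The last clause
  ranges over all metric spaces with points in the type \<open>'z\<close>, as a definition cannot
  quantify over types.\<close>

definition L_star :: "'z itself \<Rightarrow> 'a metric \<Rightarrow> bool" where
  "L_star (_ :: 'z itself) Y \<longleftrightarrow>
     (\<forall>U D. openin (mtopology_of Y) U \<and> compactin (mtopology_of Y) D \<and> D \<subseteq> U \<longrightarrow>
       (\<exists>\<N> \<Phi>.
          openin (open_lip_embedding_space (submetric Y U) Y) \<N> \<and>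
          restrict id U \<in> \<N> \<and>
          (\<forall>h\<in>\<N>. lip_iso Y Y (\<Phi> h) \<and> (\<forall>x\<in>D. \<Phi> h x = h x) \<and>
             (\<forall>x\<in>mspace Y - U. \<Phi> h x = x)) \<and>
          continuous_map
            (subtopology (open_lip_embedding_space (submetric Y U) Y) \<N>)
            (compact_open_topology (mtopology_of Y) (mtopology_of Y)) \<Phi> \<and>
          \<Phi> (restrict id U) = restrict id (mspace Y) \<and>
          (\<forall>(Z :: 'z metric) h.
             lip_isotopy Z (submetric Y U) Y h \<and> (\<forall>t\<in>mspace Z. h t \<in> \<N>) \<longrightarrow>
             lip_isotopy Z Y Y (\<lambda>t. \<Phi> (h t)))))"

section \<open>Neighbourhoods\<close>

definition nhd_of :: "'a topology \<Rightarrow> 'a set \<Rightarrow> 'a set \<Rightarrow> bool" where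
  "nhd_of T S N \<longleftrightarrow> N \<subseteq> topspace T \<and> S \<subseteq> T interior_of N"

end

theory Submission
  imports Defs
begin

text \<open>View \<open>V\<close> as an open subset of \<open>X\<close> via \<open>p = f b\<close>. On a relatively compact open set \<open>U\<close>
  around a compact collar \<open>D\<close> surrounding \<open>C\<close>, the embeddings \<open>h t = p\<inverse> \<circ> f t\<close> are near the
  inclusion for \<open>t\<close> near \<open>b\<close>, so \<open>L*\<close> provides isomorphisms of \<open>V - C\<close> that agree with
  \<open>h t\<close> on \<open>D\<close> and are supported in \<open>U\<close>; transported to \<open>X\<close> they give an isotopy \<open>G\<close> of \<open>X\<close>.
  Then \<open>E t = (G t)\<inverse> \<circ> f t\<close> agrees with \<open>p\<close> on the collar, which suggests letting \<open>H t\<close> be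
  \<open>E t \<circ> p\<inverse>\<close> inside the collar and the identity outside. For \<open>H t\<close> to be bijective, \<open>E t\<close> must
  have the same image as \<open>p\<close> on the inside. This holds over a connected neighbourhood of \<open>b\<close>:
  the tracks \<open>t \<mapsto> E t x\<close> cannot cross the collar, and the image is relatively clopen there because
  \<open>f t ` C\<close> is closed. Finally \<open>F t = G t \<circ> H t\<close>.\<close>

section \<open>Sum metrics and their topology\<close>

lemma metric_eqI:
  assumes "mspace m1 = mspace m2" "mdist m1 = mdist m2"
  shows "m1 = m2"
  using assms by (metis submetric_def submetric_mspace)

lemma mdist_self [simp]: "x \<in> mspace m \<Longrightarrow> mdist m x x = 0"
  by simp

lemma submetric_sum_metric:
  "submetric (sum_metric m1 m2) (S \<times> T) = sum_metric (submetric m1 S) (submetric m2 T)"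
  by (rule metric_eqI) auto

lemma openin_mtopology_of:
  "openin (mtopology_of m) U \<longleftrightarrow>
     U \<subseteq> mspace m \<and> (\<forall>x\<in>U. \<exists>r>0. \<forall>y\<in>mspace m. mdist m x y < r \<longrightarrow> y \<in> U)"
proof -
  interpret Metric_space "mspace m" "mdist m" by simp
  show ?thesis
    unfolding mtopology_of_def openin_mtopology subset_iff in_mball by blast
qed

text \<open>A product of two balls of radius \<open>r/2\<close> lies in the \<open>r\<close>-ball of
  the sum metric, and the sum distance bounds both coordinate distances. This makes the tube lemma
  and openness of product sets available for sum metrics.\<close>

lemma mtopology_of_sum_metric:
  "mtopology_of (sum_metric m1 m2) = prod_topology (mtopology_of m1) (mtopology_of m2)"
proof (subst topology_eq, intro allI iffI)
  fix S assume S: "openin (mtopology_of (sum_metric m1 m2)) S"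
  show "openin (prod_topology (mtopology_of m1) (mtopology_of m2)) S"
    unfolding openin_prod_topology_alt
  proof (intro allI impI)
    fix x y assume xy: "(x, y) \<in> S"
    with S obtain r where r: "r > 0" "x \<in> mspace m1" "y \<in> mspace m2"
      and sub: "\<And>u v. u \<in> mspace m1 \<Longrightarrow> v \<in> mspace m2 \<Longrightarrow> mdist m1 x u + mdist m2 y v < r \<Longrightarrow> (u, v) \<in> S"
      unfolding openin_mtopology_of by fastforce
    define U where "U = mball_of m1 x (r/2)"
    define V where "V = mball_of m2 y (r/2)"
    have "openin (mtopology_of m1) U" "openin (mtopology_of m2) V"
      unfolding U_def V_def mball_of_def mtopology_of_def
      by (simp_all add: Metric_space.openin_mball)
    moreover have "x \<in> U" "y \<in> V" using r by (simp_all add: U_def V_def)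
    moreover have "U \<times> V \<subseteq> S"
    proof
      fix q assume "q \<in> U \<times> V"
      then obtain u v where "q = (u, v)" "u \<in> mspace m1" "v \<in> mspace m2"
        "mdist m1 x u < r/2" "mdist m2 y v < r/2" by (auto simp: U_def V_def)
      then show "q \<in> S" using sub[of u v] by simp
    qed
    ultimately show "\<exists>U V. openin (mtopology_of m1) U \<and> openin (mtopology_of m2) V \<and> x \<in> U \<and> y \<in> V \<and> U \<times> V \<subseteq> S"
      by blast
  qed
next
  fix S assume S: "openin (prod_topology (mtopology_of m1) (mtopology_of m2)) S"
  show "openin (mtopology_of (sum_metric m1 m2)) S"
    unfolding openin_mtopology_of
  proof (intro conjI ballI)
    show "S \<subseteq> mspace (sum_metric m1 m2)" using openin_subset[OF S] by simp
    fix p assume "p \<in> S"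
    then obtain U V where U: "openin (mtopology_of m1) U" "fst p \<in> U"
      and V: "openin (mtopology_of m2) V" "snd p \<in> V" and UV: "U \<times> V \<subseteq> S"
      using S unfolding openin_prod_topology_alt by (metis prod.collapse)
    obtain r where r: "r > 0" "\<And>y. y \<in> mspace m1 \<Longrightarrow> mdist m1 (fst p) y < r \<Longrightarrow> y \<in> U"
      using U unfolding openin_mtopology_of by blast
    obtain s where s: "s > 0" "\<And>y. y \<in> mspace m2 \<Longrightarrow> mdist m2 (snd p) y < s \<Longrightarrow> y \<in> V"
      using V unfolding openin_mtopology_of by blast
    have "q \<in> S" if q: "q \<in> mspace (sum_metric m1 m2)"
      and d: "mdist (sum_metric m1 m2) p q < min r s" for q
    proof -
      have "mdist m1 (fst p) (fst q) + mdist m2 (snd p) (snd q) < r"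
        "mdist m1 (fst p) (fst q) + mdist m2 (snd p) (snd q) < s" using d by simp_all
      moreover have "mdist m1 (fst p) (fst q) \<ge> 0" "mdist m2 (snd p) (snd q) \<ge> 0" by simp_all
      ultimately have "mdist m1 (fst p) (fst q) < r" "mdist m2 (snd p) (snd q) < s" by linarith+
      then have "fst q \<in> U" "snd q \<in> V" using r s q by auto
      then show ?thesis using UV by (metis mem_Sigma_iff prod.collapse subsetD)
    qed
    then show "\<exists>r>0. \<forall>y\<in>mspace (sum_metric m1 m2). mdist (sum_metric m1 m2) p y < r \<longrightarrow> y \<in> S"
      using r s by (intro exI[of _ "min r s"]) auto
  qed
qed

section \<open>Locally Lipschitz maps\<close>

text \<open>An open \<open>W\<close> lies in the carrier, so the carrier of
  \<open>submetric m1 W\<close> is \<open>W\<close> itself and the local condition becomes an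
  explicit estimate.\<close>

lemma lip_map_iff:
  "lip_map m1 m2 f \<longleftrightarrow>
     f \<in> mspace m1 \<rightarrow> mspace m2 \<and>
     (\<forall>x\<in>mspace m1. \<exists>W L. openin (mtopology_of m1) W \<and> x \<in> W \<and>
        (\<forall>y\<in>W. \<forall>z\<in>W. mdist m2 (f y) (f z) \<le> L * mdist m1 y z))"
proof -
  have "Lipschitz_continuous_map (submetric m1 W) m2 f \<longleftrightarrow>
      (\<exists>L. \<forall>y\<in>W. \<forall>z\<in>W. mdist m2 (f y) (f z) \<le> L * mdist m1 y z)"
    if "openin (mtopology_of m1) W" "f \<in> mspace m1 \<rightarrow> mspace m2" for W
  proof -
    have "W \<inter> mspace m1 = W" using openin_subset[OF that(1)] by auto
    then show ?thesis using that(2) unfolding Lipschitz_continuous_map_def by auto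
  qed
  then have "(\<exists>W. openin (mtopology_of m1) W \<and> x \<in> W \<and> Lipschitz_continuous_map (submetric m1 W) m2 f) \<longleftrightarrow>
      (\<exists>W L. openin (mtopology_of m1) W \<and> x \<in> W \<and>
        (\<forall>y\<in>W. \<forall>z\<in>W. mdist m2 (f y) (f z) \<le> L * mdist m1 y z))"
    if "f \<in> mspace m1 \<rightarrow> mspace m2" for x
    using that by (simp cong: conj_cong)
  then show ?thesis unfolding lip_map_def by (simp cong: conj_cong)
qed

lemma lip_map_maps: "lip_map m1 m2 f \<Longrightarrow> f \<in> mspace m1 \<rightarrow> mspace m2"
  unfolding lip_map_def by blast

lemma lip_mapE:
  assumes "lip_map m1 m2 f" "x \<in> mspace m1"
  obtains W L where "openin (mtopology_of m1) W" "x \<in> W"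
    "\<forall>y\<in>W. \<forall>z\<in>W. mdist m2 (f y) (f z) \<le> L * mdist m1 y z"
proof -
  have "\<exists>W L. openin (mtopology_of m1) W \<and> x \<in> W \<and>
      (\<forall>y\<in>W. \<forall>z\<in>W. mdist m2 (f y) (f z) \<le> L * mdist m1 y z)"
    using assms unfolding lip_map_iff by (elim conjE) (erule (1) bspec)
  then show thesis by (elim exE conjE) (erule (2) that)
qed

lemma lip_map_local:
  assumes "\<And>x. x \<in> mspace m1 \<Longrightarrow>
    \<exists>W. openin (mtopology_of m1) W \<and> x \<in> W \<and> lip_map (submetric m1 W) m2 f"
  shows "lip_map m1 m2 f"
  unfolding lip_map_iff
proof (intro conjI ballI)
  show "f \<in> mspace m1 \<rightarrow> mspace m2"
    using assms unfolding lip_map_iff by (fastforce simp: Pi_iff)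
  fix x assume "x \<in> mspace m1"
  then obtain W where W: "openin (mtopology_of m1) W" "x \<in> W" "lip_map (submetric m1 W) m2 f"
    using assms by blast
  then have "x \<in> mspace (submetric m1 W)" using openin_subset by fastforce
  with W(3) obtain W' L where "openin (mtopology_of (submetric m1 W)) W'" "x \<in> W'"
    "\<forall>y\<in>W'. \<forall>z\<in>W'. mdist m2 (f y) (f z) \<le> L * mdist (submetric m1 W) y z"
    by (rule lip_mapE)
  then show "\<exists>W L. openin (mtopology_of m1) W \<and> x \<in> W \<and>
      (\<forall>y\<in>W. \<forall>z\<in>W. mdist m2 (f y) (f z) \<le> L * mdist m1 y z)"
    using W(1) unfolding mtopology_of_submetric mdist_submetric by (metis openin_trans_full)
qed

lemma lip_map_submetric:
  assumes "lip_map m1 m2 f"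
  shows "lip_map (submetric m1 S) m2 f"
  unfolding lip_map_iff
proof (intro conjI ballI)
  show "f \<in> mspace (submetric m1 S) \<rightarrow> mspace m2"
    using lip_map_maps[OF assms] by auto
  fix x assume x: "x \<in> mspace (submetric m1 S)"
  then have "x \<in> mspace m1" by simp
  with assms obtain W L where "openin (mtopology_of m1) W" "x \<in> W"
    "\<forall>y\<in>W. \<forall>z\<in>W. mdist m2 (f y) (f z) \<le> L * mdist m1 y z"
    by (rule lip_mapE)
  moreover from this have "openin (mtopology_of (submetric m1 S)) (W \<inter> S)"
    by (simp add: mtopology_of_submetric openin_subtopology_Int)
  ultimately show "\<exists>W L. openin (mtopology_of (submetric m1 S)) W \<and> x \<in> W \<and>
      (\<forall>y\<in>W. \<forall>z\<in>W. mdist m2 (f y) (f z) \<le> L * mdist (submetric m1 S) y z)"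
    using x by (intro exI[of _ "W \<inter> S"] exI[of _ L]) auto
qed

lemma lip_map_into_submetric:
  "lip_map m1 (submetric m2 S) f \<longleftrightarrow> lip_map m1 m2 f \<and> f ` mspace m1 \<subseteq> S"
  unfolding lip_map_iff by auto

lemma lip_map_cong:
  assumes "lip_map m1 m2 f" "\<And>x. x \<in> mspace m1 \<Longrightarrow> f x = g x"
  shows "lip_map m1 m2 g"
  unfolding lip_map_iff
proof (intro conjI ballI)
  show "g \<in> mspace m1 \<rightarrow> mspace m2" using assms unfolding lip_map_iff Pi_iff by auto
  fix x assume "x \<in> mspace m1"
  then obtain W L where W: "openin (mtopology_of m1) W" "x \<in> W"
    "\<forall>y\<in>W. \<forall>z\<in>W. mdist m2 (f y) (f z) \<le> L * mdist m1 y z"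
    using assms(1) unfolding lip_map_iff by blast
  moreover have "f y = g y" if "y \<in> W" for y
    using openin_subset[OF W(1)] that assms(2) by auto
  ultimately show "\<exists>W L. openin (mtopology_of m1) W \<and> x \<in> W \<and>
      (\<forall>y\<in>W. \<forall>z\<in>W. mdist m2 (g y) (g z) \<le> L * mdist m1 y z)"
    by (intro exI[of _ W] exI[of _ L]) simp
qed

lemma lip_map_continuous:
  assumes "lip_map m1 m2 f"
  shows "continuous_map (mtopology_of m1) (mtopology_of m2) f"
proof -
  obtain W where W: "\<And>x. x \<in> mspace m1 \<Longrightarrow> openin (mtopology_of m1) (W x)"
    "\<And>x. x \<in> mspace m1 \<Longrightarrow> x \<in> W x"
    "\<And>x. x \<in> mspace m1 \<Longrightarrow> Lipschitz_continuous_map (submetric m1 (W x)) m2 f"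
    using assms unfolding lip_map_def by metis
  show ?thesis
  proof (rule pasting_lemma[where I = "mspace m1" and T = W and f = "\<lambda>_. f"])
    fix x assume x: "x \<in> mspace m1"
    show "openin (mtopology_of m1) (W x)" by (rule W(1)[OF x])
    show "continuous_map (subtopology (mtopology_of m1) (W x)) (mtopology_of m2) f"
      using Lipschitz_continuous_imp_continuous_map[OF W(3)[OF x]] by (simp add: mtopology_of_submetric)
  next
    fix x assume "x \<in> topspace (mtopology_of m1)"
    then show "\<exists>j. j \<in> mspace m1 \<and> x \<in> W j \<and> f x = f x" using W(2)[of x] by auto
  qed auto
qed

lemma lip_map_compose:
  assumes f: "lip_map m1 m2 f" and g: "lip_map m2 m3 g"
  shows "lip_map m1 m3 (\<lambda>x. g (f x))"
  unfolding lip_map_iff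
proof (intro conjI ballI)
  show "(\<lambda>x. g (f x)) \<in> mspace m1 \<rightarrow> mspace m3"
    using lip_map_maps[OF f] lip_map_maps[OF g] by auto
  fix x assume x: "x \<in> mspace m1"
  obtain W L where W: "openin (mtopology_of m1) W" "x \<in> W"
    "\<forall>y\<in>W. \<forall>z\<in>W. mdist m2 (f y) (f z) \<le> L * mdist m1 y z"
    by (rule lip_mapE[OF f x])
  have fx: "f x \<in> mspace m2" using lip_map_maps[OF f] x by auto
  obtain W' L' where W': "openin (mtopology_of m2) W'" "f x \<in> W'"
    "\<forall>y\<in>W'. \<forall>z\<in>W'. mdist m3 (g y) (g z) \<le> L' * mdist m2 y z"
    by (rule lip_mapE[OF g fx])
  let ?W = "W \<inter> {y \<in> mspace m1. f y \<in> W'}"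
  have "openin (mtopology_of m1) ?W"
    using W(1) openin_continuous_map_preimage[OF lip_map_continuous[OF f] W'(1)] by auto
  \<comment> \<open>The local constants carry no sign condition; absolute values make the
    multiplications monotone.\<close>
  moreover have "mdist m3 (g (f y)) (g (f z)) \<le> \<bar>L'\<bar> * \<bar>L\<bar> * mdist m1 y z"
    if "y \<in> ?W" "z \<in> ?W" for y z
  proof -
    have "mdist m3 (g (f y)) (g (f z)) \<le> L' * mdist m2 (f y) (f z)"
      using that W' by simp
    also have "\<dots> \<le> \<bar>L'\<bar> * mdist m2 (f y) (f z)" by (simp add: mult_right_mono)
    also have "\<dots> \<le> \<bar>L'\<bar> * (L * mdist m1 y z)" using that W by (simp add: mult_left_mono)
    also have "\<dots> \<le> \<bar>L'\<bar> * (\<bar>L\<bar> * mdist m1 y z)"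
      by (intro mult_left_mono mult_right_mono) auto
    finally show ?thesis by (simp add: mult.assoc)
  qed
  ultimately show "\<exists>W L. openin (mtopology_of m1) W \<and> x \<in> W \<and>
      (\<forall>y\<in>W. \<forall>z\<in>W. mdist m3 (g (f y)) (g (f z)) \<le> L * mdist m1 y z)"
    using x W(2) W'(2) by (intro exI[of _ ?W] exI[of _ "\<bar>L'\<bar> * \<bar>L\<bar>"]) auto
qed

lemma lip_map_id: "lip_map m m (\<lambda>x. x)"
  unfolding lip_map_iff
  by (intro conjI ballI exI[of _ "mspace m"] exI[of _ 1]) (auto simp: openin_mtopology_of gt_ex)

lemma lip_map_fst: "lip_map (sum_metric m1 m2) m1 fst"
  unfolding lip_map_iff
  by (intro conjI ballI exI[of _ "mspace (sum_metric m1 m2)"] exI[of _ 1])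
    (auto simp: openin_mtopology_of gt_ex)

lemma lip_map_snd: "lip_map (sum_metric m1 m2) m2 snd"
  unfolding lip_map_iff
  by (intro conjI ballI exI[of _ "mspace (sum_metric m1 m2)"] exI[of _ 1])
    (auto simp: openin_mtopology_of gt_ex)

lemma lip_map_const: "c \<in> mspace m2 \<Longrightarrow> lip_map m1 m2 (\<lambda>x. c)"
  unfolding lip_map_iff
  by (intro conjI ballI exI[of _ "mspace m1"] exI[of _ 0]) (auto simp: openin_mtopology_of gt_ex)

lemma lip_map_Pair:
  assumes f: "lip_map m m1 f" and g: "lip_map m m2 g"
  shows "lip_map m (sum_metric m1 m2) (\<lambda>x. (f x, g x))"
  unfolding lip_map_iff
proof (intro conjI ballI)
  show "(\<lambda>x. (f x, g x)) \<in> mspace m \<rightarrow> mspace (sum_metric m1 m2)"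
    using lip_map_maps[OF f] lip_map_maps[OF g] by auto
  fix x assume x: "x \<in> mspace m"
  obtain W L where W: "openin (mtopology_of m) W" "x \<in> W"
    "\<forall>y\<in>W. \<forall>z\<in>W. mdist m1 (f y) (f z) \<le> L * mdist m y z"
    by (rule lip_mapE[OF f x])
  obtain W' L' where W': "openin (mtopology_of m) W'" "x \<in> W'"
    "\<forall>y\<in>W'. \<forall>z\<in>W'. mdist m2 (g y) (g z) \<le> L' * mdist m y z"
    by (rule lip_mapE[OF g x])
  show "\<exists>W L. openin (mtopology_of m) W \<and> x \<in> W \<and>
      (\<forall>y\<in>W. \<forall>z\<in>W. mdist (sum_metric m1 m2) (f y, g y) (f z, g z) \<le> L * mdist m y z)"
    using W W' by (intro exI[of _ "W \<inter> W'"] exI[of _ "L + L'"])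
      (auto simp: ring_distribs intro!: add_mono)
qed

section \<open>Open Lipschitz embeddings\<close>

text \<open>Working criterion: any Lipschitz left inverse \<open>g\<close> on the image may replace
  \<open>inv_into\<close>, and openness of the map reduces to openness of its image, because the
  image of an open set is its preimage under the continuous \<open>g\<close>.\<close>

lemma open_lip_embedding_iff:
  "open_lip_embedding m1 m2 f \<longleftrightarrow>
     lip_map m1 m2 f \<and> openin (mtopology_of m2) (f ` mspace m1) \<and>
     (\<exists>g. lip_map (submetric m2 (f ` mspace m1)) m1 g \<and> (\<forall>x\<in>mspace m1. g (f x) = x))"
    (is "?L \<longleftrightarrow> ?R")
proof
  assume ?L
  then have "inj_on f (mspace m1)" unfolding open_lip_embedding_def lip_embedding_def by auto
  with \<open>?L\<close> show ?R unfolding open_lip_embedding_def lip_embedding_def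
    by (metis inv_into_f_f lip_map_into_submetric open_map_def openin_topspace topspace_mtopology_of)
next
  assume ?R
  then obtain g where f: "lip_map m1 m2 f" and op: "openin (mtopology_of m2) (f ` mspace m1)"
    and g: "lip_map (submetric m2 (f ` mspace m1)) m1 g" and gf: "\<And>x. x \<in> mspace m1 \<Longrightarrow> g (f x) = x"
    by blast
  have inj: "inj_on f (mspace m1)" by (metis gf inj_on_inverseI)
  have ffun: "f \<in> mspace m1 \<rightarrow> mspace m2" using lip_map_maps[OF f] .
  have "lip_map (submetric m2 (f ` mspace m1)) m1 (inv_into (mspace m1) f)"
    by (rule lip_map_cong[OF g]) (auto simp: gf inj)
  moreover have "open_map (mtopology_of m1) (mtopology_of m2) f"
    unfolding open_map_def
  proof (intro allI impI)
    fix O' assume O: "openin (mtopology_of m1) O'"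
    have "openin (mtopology_of (submetric m2 (f ` mspace m1)))
        {y \<in> mspace (submetric m2 (f ` mspace m1)). g y \<in> O'}"
      using openin_continuous_map_preimage[OF lip_map_continuous[OF g] O] by simp
    moreover have "{y \<in> mspace (submetric m2 (f ` mspace m1)). g y \<in> O'} = f ` O'"
      using ffun gf openin_subset[OF O] by (auto simp: subset_iff)
    ultimately show "openin (mtopology_of m2) (f ` O')"
      using op by (metis mtopology_of_submetric openin_trans_full)
  qed
  ultimately show ?L
    using inj ffun f unfolding open_lip_embedding_def lip_embedding_def lip_map_into_submetric by auto
qed

lemma open_lip_embedding_cong:
  assumes "open_lip_embedding m1 m2 f" "\<And>x. x \<in> mspace m1 \<Longrightarrow> f x = g x"
  shows "open_lip_embedding m1 m2 g"
proof -
  have "f ` mspace m1 = g ` mspace m1" using assms(2) by auto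
  then show ?thesis
    using assms lip_map_cong[of m1 m2 f g] unfolding open_lip_embedding_iff by metis
qed

lemma open_lip_embedding_image:
  "open_lip_embedding m1 m2 f \<Longrightarrow> openin (mtopology_of m1) W \<Longrightarrow> openin (mtopology_of m2) (f ` W)"
  unfolding open_lip_embedding_def open_map_def by blast

lemma open_lip_embedding_submetric:
  assumes f: "open_lip_embedding m1 m2 f" and W: "openin (mtopology_of m1) W"
  shows "open_lip_embedding (submetric m1 W) m2 f"
proof -
  have W1: "W \<inter> mspace m1 = W" "W \<subseteq> mspace m1" using openin_subset[OF W] by auto
  obtain g where g: "lip_map (submetric m2 (f ` mspace m1)) m1 g" "\<And>x. x \<in> mspace m1 \<Longrightarrow> g (f x) = x"
    using f unfolding open_lip_embedding_iff by blast
  have "lip_map (submetric (submetric m2 (f ` mspace m1)) (f ` W)) m1 g"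
    by (rule lip_map_submetric[OF g(1)])
  moreover have "f ` mspace m1 \<inter> f ` W = f ` W" using W1 by blast
  ultimately have "lip_map (submetric m2 (f ` W)) m1 g" by simp
  then have "lip_map (submetric m2 (f ` W)) (submetric m1 W) g"
    unfolding lip_map_into_submetric using g(2) W1 by auto
  then show ?thesis
    unfolding open_lip_embedding_iff
    using f open_lip_embedding_image[OF f W] W1 g(2)
    by (auto simp: open_lip_embedding_iff lip_map_submetric)
qed

lemma open_lip_embedding_into_submetric:
  assumes f: "open_lip_embedding m1 m2 f" and S: "f ` mspace m1 \<subseteq> S"
  shows "open_lip_embedding m1 (submetric m2 S) f"
proof -
  have "openin (mtopology_of (submetric m2 S)) (f ` mspace m1)"
    using f S unfolding open_lip_embedding_iff mtopology_of_submetric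
    by (simp add: subset_openin_subtopology)
  moreover have "S \<inter> f ` mspace m1 = f ` mspace m1" using S by blast
  ultimately show ?thesis using f S unfolding open_lip_embedding_iff lip_map_into_submetric
    by simp
qed

lemma open_lip_embedding_compose:
  assumes f: "open_lip_embedding m1 m2 f" and g: "open_lip_embedding m2 m3 g"
  shows "open_lip_embedding m1 m3 (\<lambda>x. g (f x))"
proof -
  have ff: "f ` mspace m1 \<subseteq> mspace m2" using f unfolding open_lip_embedding_iff by (auto dest: lip_map_maps)
  obtain f' where f': "lip_map (submetric m2 (f ` mspace m1)) m1 f'" "\<And>x. x \<in> mspace m1 \<Longrightarrow> f' (f x) = x"
    using f unfolding open_lip_embedding_iff by blast
  obtain g' where g': "lip_map (submetric m3 (g ` mspace m2)) m2 g'" "\<And>x. x \<in> mspace m2 \<Longrightarrow> g' (g x) = x"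
    using g unfolding open_lip_embedding_iff by blast
  let ?I = "(\<lambda>x. g (f x)) ` mspace m1"
  have "lip_map (submetric (submetric m3 (g ` mspace m2)) ?I) (submetric m2 (f ` mspace m1)) g'"
    unfolding lip_map_into_submetric using lip_map_submetric[OF g'(1)] g'(2) ff by auto
  moreover have "g ` mspace m2 \<inter> ?I = ?I" using ff by auto
  ultimately have "lip_map (submetric m3 ?I) m1 (\<lambda>y. f' (g' y))"
    using lip_map_compose[OF _ f'(1)] by auto
  moreover have "openin (mtopology_of m3) ?I"
    using open_lip_embedding_image[OF g, of "f ` mspace m1"] f
    by (simp add: open_lip_embedding_iff image_image)
  moreover have "lip_map m1 m3 (\<lambda>x. g (f x))"
    using f g lip_map_compose unfolding open_lip_embedding_iff by blast
  ultimately show ?thesis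
    unfolding open_lip_embedding_iff using ff f'(2) g'(2) by (auto simp: image_subset_iff)
qed

text \<open>A lift \<open>r\<close> of \<open>p\<close> through \<open>q\<close> is \<open>p\<close>
  followed by the inverse of \<open>q\<close>, and its inverse is \<open>q\<close> followed by the
  inverse of \<open>p\<close>. Its image is open as the preimage under \<open>q\<close> of the image
  of \<open>p\<close>.\<close>

lemma open_lip_embedding_cancel:
  assumes p: "open_lip_embedding m1 m3 p" and q: "open_lip_embedding m2 m3 q"
    and r: "\<And>x. x \<in> mspace m1 \<Longrightarrow> r x \<in> mspace m2 \<and> q (r x) = p x"
  shows "open_lip_embedding m1 m2 r"
proof -
  obtain p' where p': "lip_map (submetric m3 (p ` mspace m1)) m1 p'" "\<And>x. x \<in> mspace m1 \<Longrightarrow> p' (p x) = x"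
    using p unfolding open_lip_embedding_iff by blast
  obtain q' where q': "lip_map (submetric m3 (q ` mspace m2)) m2 q'" "\<And>x. x \<in> mspace m2 \<Longrightarrow> q' (q x) = x"
    using q unfolding open_lip_embedding_iff by blast
  have qlip: "lip_map m2 m3 q" and plip: "lip_map m1 m3 p"
    using p q unfolding open_lip_embedding_iff by auto
  have "p ` mspace m1 \<subseteq> q ` mspace m2" using r by (metis image_eqI image_subsetI)
  then have "lip_map m1 (submetric m3 (q ` mspace m2)) p"
    unfolding lip_map_into_submetric using plip by blast
  from lip_map_compose[OF this q'(1)] have rlip: "lip_map m1 m2 r"
    by (rule lip_map_cong) (metis r q'(2))
  have *: "r ` mspace m1 = {y \<in> mspace m2. q y \<in> p ` mspace m1}"
    using r q'(2) by (auto simp: image_iff) metis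
  have "openin (mtopology_of m2) (r ` mspace m1)"
    unfolding * using openin_continuous_map_preimage[OF lip_map_continuous[OF qlip]] p
    by (simp add: open_lip_embedding_iff)
  moreover have "lip_map (submetric m2 (r ` mspace m1)) (submetric m3 (p ` mspace m1)) q"
    unfolding lip_map_into_submetric using lip_map_submetric[OF qlip] r by auto
  then have "lip_map (submetric m2 (r ` mspace m1)) m1 (\<lambda>y. p' (q y))"
    by (rule lip_map_compose[OF _ p'(1)])
  ultimately show ?thesis
    unfolding open_lip_embedding_iff using rlip r p'(2) by metis
qed

text \<open>Global injectivity gives one inverse on the whole image; on each open piece it coincides
  with the local inverse, and being Lipschitz is a local condition.\<close>

lemma open_lip_embedding_local:
  assumes inj: "inj_on f (mspace m1)"
    and loc: "\<And>x. x \<in> mspace m1 \<Longrightarrow>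
      \<exists>W. openin (mtopology_of m1) W \<and> x \<in> W \<and> open_lip_embedding (submetric m1 W) m2 f"
  shows "open_lip_embedding m1 m2 f"
proof -
  obtain W where W: "\<And>x. x \<in> mspace m1 \<Longrightarrow> openin (mtopology_of m1) (W x)"
    "\<And>x. x \<in> mspace m1 \<Longrightarrow> x \<in> W x"
    "\<And>x. x \<in> mspace m1 \<Longrightarrow> open_lip_embedding (submetric m1 (W x)) m2 f"
    using loc by metis
  have Ws: "W x \<subseteq> mspace m1" if "x \<in> mspace m1" for x
    using openin_subset[OF W(1)[OF that]] by simp
  then have Wi: "W x \<inter> mspace m1 = W x" if "x \<in> mspace m1" for x using that by blast
  have f: "lip_map m1 m2 f"
    by (rule lip_map_local) (use W in \<open>auto simp: open_lip_embedding_iff\<close>)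
  have fW: "openin (mtopology_of m2) (f ` W x)" if "x \<in> mspace m1" for x
    using W(3)[OF that] Wi[OF that] by (simp add: open_lip_embedding_iff)
  have "f ` mspace m1 = (\<Union>x\<in>mspace m1. f ` W x)" using W(2) Ws by blast
  then have op: "openin (mtopology_of m2) (f ` mspace m1)" using fW by auto
  let ?g = "inv_into (mspace m1) f"
  have "lip_map (submetric m2 (f ` mspace m1)) m1 ?g"
  proof (rule lip_map_local)
    fix y assume "y \<in> mspace (submetric m2 (f ` mspace m1))"
    then obtain x where x: "x \<in> mspace m1" "y = f x" by auto
    obtain g where g: "lip_map (submetric m2 (f ` W x)) (submetric m1 (W x)) g" "\<forall>z\<in>W x. g (f z) = z"
      using W(3)[OF x(1)] Wi[OF x(1)] unfolding open_lip_embedding_iff by auto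
    have "lip_map (submetric m2 (f ` W x)) m1 ?g"
      using g(1) unfolding lip_map_into_submetric
      by (elim conjE lip_map_cong) (use g(2) Ws[OF x(1)] inj in auto)
    moreover have "f ` mspace m1 \<inter> f ` W x = f ` W x" using Ws[OF x(1)] by blast
    moreover have "openin (mtopology_of (submetric m2 (f ` mspace m1))) (f ` W x)"
      using fW[OF x(1)] Ws[OF x(1)] unfolding mtopology_of_submetric
      by (simp add: image_mono subset_openin_subtopology)
    ultimately show "\<exists>W. openin (mtopology_of (submetric m2 (f ` mspace m1))) W \<and> y \<in> W \<and>
        lip_map (submetric (submetric m2 (f ` mspace m1)) W) m1 ?g"
      using x W(2) by (intro exI[of _ "f ` W x"]) auto
  qed
  then show ?thesis using f op inj unfolding open_lip_embedding_iff by (metis inv_into_f_f)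
qed

lemma open_lip_embedding_imp_lip_iso:
  assumes "open_lip_embedding m1 m2 f" "f ` mspace m1 = mspace m2"
  shows "lip_iso m1 m2 f"
  using assms unfolding lip_iso_def open_lip_embedding_def lip_embedding_def bij_betw_def by auto

lemma open_lip_embedding_inj: "open_lip_embedding m1 m2 f \<Longrightarrow> inj_on f (mspace m1)"
  unfolding open_lip_embedding_def lip_embedding_def by auto

lemma open_lip_embedding_maps: "open_lip_embedding m1 m2 f \<Longrightarrow> x \<in> mspace m1 \<Longrightarrow> f x \<in> mspace m2"
  unfolding open_lip_embedding_iff by (auto dest: lip_map_maps)

lemma open_lip_embedding_continuous:
  "open_lip_embedding m1 m2 f \<Longrightarrow> continuous_map (mtopology_of m1) (mtopology_of m2) f"
  unfolding open_lip_embedding_iff using lip_map_continuous by auto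

text \<open>Serves to pull local compactness of the target back to the domain.\<close>

lemma open_lip_embedding_homeomorphic:
  assumes "open_lip_embedding m1 m2 f"
  shows "mtopology_of m1 homeomorphic_space subtopology (mtopology_of m2) (f ` mspace m1)"
  using assms embedding_map_imp_homeomorphic_space[of "mtopology_of m1" "mtopology_of m2" f]
    injective_open_imp_embedding_map[OF open_lip_embedding_continuous[OF assms]] open_lip_embedding_inj[OF assms]
  unfolding open_lip_embedding_def by simp

section \<open>Lipschitz isotopies\<close>

lemma lip_isotopy_maps:
  "lip_isotopy T m1 m2 h \<Longrightarrow> t \<in> mspace T \<Longrightarrow> x \<in> mspace m1 \<Longrightarrow> h t x \<in> mspace m2"
  unfolding lip_isotopy_def using open_lip_embedding_maps by fastforce

lemma lip_isotopy_cong: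
  assumes "lip_isotopy T m1 m2 h" "\<And>t x. t \<in> mspace T \<Longrightarrow> x \<in> mspace m1 \<Longrightarrow> h t x = k t x"
  shows "lip_isotopy T m1 m2 k"
  using assms unfolding lip_isotopy_def by (elim open_lip_embedding_cong) auto

text \<open>Allows a single embedding to be composed with, or cancelled from, an isotopy over any
  base.\<close>

lemma lip_isotopy_const:
  assumes f: "open_lip_embedding m1 m2 f"
  shows "lip_isotopy T m1 m2 (\<lambda>_. f)"
  unfolding lip_isotopy_def case_prod_beta
proof -
  obtain g where g: "lip_map (submetric m2 (f ` mspace m1)) m1 g" "\<And>x. x \<in> mspace m1 \<Longrightarrow> g (f x) = x"
    using f unfolding open_lip_embedding_iff by blast
  have flip: "lip_map m1 m2 f" and op: "openin (mtopology_of m2) (f ` mspace m1)"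
    using f unfolding open_lip_embedding_iff by auto
  have im: "(\<lambda>p. (fst p, f (snd p))) ` mspace (sum_metric T m1) = mspace T \<times> f ` mspace m1"
    by force
  have lip: "lip_map (sum_metric T m1) (sum_metric T m2) (\<lambda>p. (fst p, f (snd p)))"
    by (intro lip_map_Pair lip_map_fst lip_map_compose[OF lip_map_snd flip])
  have "openin (mtopology_of T) (mspace T)" by (metis openin_topspace topspace_mtopology_of)
  then have "openin (mtopology_of (sum_metric T m2)) (mspace T \<times> f ` mspace m1)"
    using op by (simp add: mtopology_of_sum_metric openin_prod_Times_iff)
  moreover have "lip_map (sum_metric T (submetric m2 (f ` mspace m1))) (sum_metric T m1)
      (\<lambda>p. (fst p, g (snd p)))"
    by (intro lip_map_Pair lip_map_fst lip_map_compose[OF lip_map_snd g(1)])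
  then have "lip_map (submetric (sum_metric T m2) (mspace T \<times> f ` mspace m1)) (sum_metric T m1)
      (\<lambda>p. (fst p, g (snd p)))"
    by (simp add: submetric_sum_metric)
  ultimately show "open_lip_embedding (sum_metric T m1) (sum_metric T m2) (\<lambda>p. (fst p, f (snd p)))"
    unfolding open_lip_embedding_iff im using lip g(2)
    by (intro conjI exI[of _ "\<lambda>p. (fst p, g (snd p))"]) auto
qed

text \<open>The section \<open>Pair t\<close> is Lipschitz for the sum metric. Composing the total
  map and its inverse with such sections gives the slice and its inverse, and the image of the slice
  is the preimage of the open total image under \<open>Pair t\<close>.\<close>

lemma lip_isotopy_slice:
  assumes h: "lip_isotopy T m1 m2 h" and t: "t \<in> mspace T"
  shows "open_lip_embedding m1 m2 (h t)"
proof -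
  let ?H = "\<lambda>(t, x). (t, h t x)"
  let ?I = "?H ` mspace (sum_metric T m1)"
  obtain g where g: "lip_map (submetric (sum_metric T m2) ?I) (sum_metric T m1) g"
    "\<And>x. x \<in> mspace (sum_metric T m1) \<Longrightarrow> g (?H x) = x"
    using h unfolding lip_isotopy_def open_lip_embedding_iff by blast
  have H: "lip_map (sum_metric T m1) (sum_metric T m2) ?H"
    and op: "openin (mtopology_of (sum_metric T m2)) ?I"
    using h unfolding lip_isotopy_def open_lip_embedding_iff by auto
  have "lip_map m1 m2 (\<lambda>x. snd (?H (t, x)))"
    by (rule lip_map_compose[OF _ lip_map_snd], rule lip_map_compose[OF _ H], rule lip_map_Pair)
      (simp_all add: lip_map_const lip_map_id t)
  then have lip: "lip_map m1 m2 (h t)" by simp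
  have sect2: "lip_map m2 (sum_metric T m2) (Pair t)"
    by (intro lip_map_Pair lip_map_const t lip_map_id)
  have eq: "h t ` mspace m1 = {y \<in> mspace m2. (t, y) \<in> ?I}"
    using t lip_map_maps[OF lip] by (auto simp: image_iff)
  have "openin (mtopology_of m2) (h t ` mspace m1)"
    unfolding eq using openin_continuous_map_preimage[OF lip_map_continuous[OF sect2] op] by simp
  moreover have "lip_map (submetric m2 (h t ` mspace m1)) (submetric (sum_metric T m2) ?I) (Pair t)"
    unfolding lip_map_into_submetric using lip_map_submetric[OF sect2] t by auto
  then have "lip_map (submetric m2 (h t ` mspace m1)) m1 (\<lambda>y. snd (g (t, y)))"
    by (intro lip_map_compose[OF _ lip_map_snd]) (rule lip_map_compose[OF _ g(1)])
  moreover have "snd (g (t, h t x)) = x" if "x \<in> mspace m1" for x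
    using g(2)[of "(t, x)"] t that by simp
  ultimately show ?thesis unfolding open_lip_embedding_iff using lip
    by (intro conjI exI[of _ "\<lambda>y. snd (g (t, y))"]) auto
qed

lemma lip_isotopy_continuous:
  assumes "lip_isotopy T m1 m2 h"
  shows "continuous_map (prod_topology (mtopology_of T) (mtopology_of m1)) (mtopology_of m2)
    (\<lambda>(t, x). h t x)"
proof -
  have "continuous_map (mtopology_of (sum_metric T m1)) (mtopology_of m2)
      (snd \<circ> (\<lambda>(t, x). (t, h t x)))"
    using assms unfolding lip_isotopy_def
    by (intro continuous_map_compose[OF open_lip_embedding_continuous lip_map_continuous[OF lip_map_snd]])
  then show ?thesis by (simp add: mtopology_of_sum_metric comp_def case_prod_unfold)
qed

lemma lip_isotopy_base:
  assumes h: "lip_isotopy T m1 m2 h" and N: "openin (mtopology_of T) N"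
  shows "lip_isotopy (submetric T N) m1 m2 h"
proof -
  have "openin (mtopology_of (sum_metric T m1)) (N \<times> mspace m1)"
    using N by (simp add: mtopology_of_sum_metric openin_prod_Times_iff)
      (metis openin_topspace topspace_mtopology_of)
  then have "open_lip_embedding (submetric (sum_metric T m1) (N \<times> mspace m1)) (sum_metric T m2)
      (\<lambda>(t, x). (t, h t x))"
    using h unfolding lip_isotopy_def by (intro open_lip_embedding_submetric)
  then have "open_lip_embedding (submetric (sum_metric T m1) (N \<times> mspace m1))
      (submetric (sum_metric T m2) (N \<times> mspace m2)) (\<lambda>(t, x). (t, h t x))"
    by (rule open_lip_embedding_into_submetric) (use lip_isotopy_maps[OF h] in auto)
  then show ?thesis unfolding lip_isotopy_def submetric_sum_metric by simp
qed

lemma lip_isotopy_submetric: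
  assumes h: "lip_isotopy T m1 m2 h" and W: "openin (mtopology_of m1) W"
  shows "lip_isotopy T (submetric m1 W) m2 h"
proof -
  have "openin (mtopology_of (sum_metric T m1)) (mspace T \<times> W)"
    using W by (simp add: mtopology_of_sum_metric openin_prod_Times_iff)
      (metis openin_topspace topspace_mtopology_of)
  then have "open_lip_embedding (submetric (sum_metric T m1) (mspace T \<times> W)) (sum_metric T m2)
      (\<lambda>(t, x). (t, h t x))"
    using h unfolding lip_isotopy_def by (intro open_lip_embedding_submetric)
  then show ?thesis unfolding lip_isotopy_def submetric_sum_metric by simp
qed

lemma lip_isotopy_compose:
  assumes h: "lip_isotopy T m1 m2 h" and k: "lip_isotopy T m2 m3 k"
  shows "lip_isotopy T m1 m3 (\<lambda>t x. k t (h t x))"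
  using open_lip_embedding_compose[OF h[unfolded lip_isotopy_def] k[unfolded lip_isotopy_def]]
  unfolding lip_isotopy_def by (simp add: case_prod_unfold)

text \<open>Division of isotopies: a family found pointwise by solving
  \<open>q t (r t x) = p t x\<close> is automatically Lipschitz jointly in \<open>t\<close> and
  \<open>x\<close>.\<close>

lemma lip_isotopy_cancel:
  assumes p: "lip_isotopy T m1 m3 p" and q: "lip_isotopy T m2 m3 q"
    and r: "\<And>t x. t \<in> mspace T \<Longrightarrow> x \<in> mspace m1 \<Longrightarrow> r t x \<in> mspace m2 \<and> q t (r t x) = p t x"
  shows "lip_isotopy T m1 m2 r"
  unfolding lip_isotopy_def
  by (rule open_lip_embedding_cancel[OF p[unfolded lip_isotopy_def] q[unfolded lip_isotopy_def]])
    (use r in auto)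

text \<open>The total map preserves the parameter, so injectivity of each slice makes it injective;
  the remaining conditions are local and hold over both open pieces.\<close>

lemma lip_isotopy_glue:
  assumes W1: "openin (mtopology_of m1) W1" and W2: "openin (mtopology_of m1) W2"
    and cover: "mspace m1 \<subseteq> W1 \<union> W2"
    and h1: "lip_isotopy T (submetric m1 W1) m2 h1" and h2: "lip_isotopy T (submetric m1 W2) m2 h2"
    and eq1: "\<And>t x. t \<in> mspace T \<Longrightarrow> x \<in> W1 \<Longrightarrow> h t x = h1 t x"
    and eq2: "\<And>t x. t \<in> mspace T \<Longrightarrow> x \<in> W2 \<Longrightarrow> h t x = h2 t x"
    and inj: "\<And>t. t \<in> mspace T \<Longrightarrow> inj_on (h t) (mspace m1)"
  shows "lip_isotopy T m1 m2 h"
  unfolding lip_isotopy_def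
proof (rule open_lip_embedding_local)
  show "inj_on (\<lambda>(t, x). (t, h t x)) (mspace (sum_metric T m1))"
    using inj by (auto simp: inj_on_def)
  have sub: "lip_isotopy T (submetric m1 W1) m2 h" "lip_isotopy T (submetric m1 W2) m2 h"
    using h1 h2 eq1 eq2 by (auto elim!: lip_isotopy_cong)
  have T: "openin (mtopology_of T) (mspace T)" by (metis openin_topspace topspace_mtopology_of)
  fix q assume "q \<in> mspace (sum_metric T m1)"
  then have "q \<in> mspace T \<times> W1 \<or> q \<in> mspace T \<times> W2" using cover by auto
  moreover have "openin (mtopology_of (sum_metric T m1)) (mspace T \<times> W) \<and>
      open_lip_embedding (submetric (sum_metric T m1) (mspace T \<times> W)) (sum_metric T m2) (\<lambda>(t, x). (t, h t x))"
    if "W = W1 \<or> W = W2" for W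
    using that sub T W1 W2 unfolding lip_isotopy_def submetric_sum_metric
    by (auto simp: mtopology_of_sum_metric openin_prod_Times_iff)
  ultimately show "\<exists>W. openin (mtopology_of (sum_metric T m1)) W \<and> q \<in> W \<and>
      open_lip_embedding (submetric (sum_metric T m1) W) (sum_metric T m2) (\<lambda>(t, x). (t, h t x))"
    by blast
qed

section \<open>The compact-open topology and compact neighbourhoods\<close>

text \<open>Currying of a jointly continuous family. For a subbasic set given by \<open>K\<close>
  and \<open>W\<close>, the tube lemma around \<open>{t} \<times> K\<close> yields a neighbourhood
  of \<open>t\<close> whose members still map \<open>K\<close> into \<open>W\<close>.\<close>

lemma continuous_map_compact_open_topology:
  assumes h: "continuous_map (prod_topology T S) R (\<lambda>(t, x). h t x)"
    and ext: "\<And>t. t \<in> topspace T \<Longrightarrow> h t \<in> extensional (topspace S)"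
  shows "continuous_map T (compact_open_topology S R) h"
  unfolding compact_open_topology_def
proof (rule continuous_on_generated_topo)
  have ht: "continuous_map S R (h t)" if "t \<in> topspace T" for t
  proof -
    have "continuous_map S (prod_topology T S) (Pair t)"
      using that by (simp add: continuous_map_pairwise comp_def)
    from continuous_map_compose[OF this h] show ?thesis by (simp add: comp_def)
  qed
  {
    fix O' assume "O' \<in> {{f. f \<in> extensional (topspace S) \<and> continuous_map S R f \<and> f ` K \<subseteq> W} | K W.
        compactin S K \<and> openin R W}"
    then obtain K W where O: "O' = {f. f \<in> extensional (topspace S) \<and> continuous_map S R f \<and> f ` K \<subseteq> W}"
      and K: "compactin S K" and W: "openin R W" by blast
    define G where "G = {q \<in> topspace (prod_topology T S). (\<lambda>(t, x). h t x) q \<in> W}"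
    have G: "openin (prod_topology T S) G"
      unfolding G_def by (rule openin_continuous_map_preimage[OF h W])
    have hG: "(t, x) \<in> G \<longleftrightarrow> t \<in> topspace T \<and> x \<in> topspace S \<and> h t x \<in> W" for t x
      by (auto simp: G_def)
    show "openin T (h -` O' \<inter> topspace T)"
    proof (subst openin_subopen, intro ballI)
      fix t assume t: "t \<in> h -` O' \<inter> topspace T"
      then have "{t} \<times> K \<subseteq> G"
        using compactin_subset_topspace[OF K] unfolding O by (fastforce simp: hG)
      then have "\<exists>A A'. openin T A \<and> openin S A' \<and> t \<in> A \<and> K \<subseteq> A' \<and> A \<times> A' \<subseteq> G"
        using tube_lemma_right[OF G K] t by (metis Int_iff)
      then obtain A A' where A: "openin T A" "t \<in> A" "K \<subseteq> A'" "A \<times> A' \<subseteq> G"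
        by (elim exE conjE)
      have "h s \<in> O'" "s \<in> topspace T" if "s \<in> A" for s
      proof -
        show s: "s \<in> topspace T" using openin_subset[OF A(1)] that by blast
        have "h s x \<in> W" if "x \<in> K" for x using hG A(3,4) that \<open>s \<in> A\<close> by blast
        then show "h s \<in> O'" unfolding O using ht[OF s] ext[OF s] by blast
      qed
      then have "A \<subseteq> h -` O' \<inter> topspace T" by blast
      with A(1,2)
      show "\<exists>A. openin T A \<and> t \<in> A \<and> A \<subseteq> h -` O' \<inter> topspace T" by blast
    qed
  }
  \<comment> \<open>The choice \<open>K = {}\<close> and \<open>W = {}\<close> gives a subbasic set
    that contains every extensional continuous map, so \<open>h\<close> takes values in the
    underlying space of the topology.\<close>
  have "h t \<in> {f. f \<in> extensional (topspace S) \<and> continuous_map S R f \<and> f ` {} \<subseteq> {}}"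
    if "t \<in> topspace T" for t
    using ht[OF that] ext[OF that] by simp
  then show "h ` topspace T \<subseteq> \<Union> {{f. f \<in> extensional (topspace S) \<and> continuous_map S R f \<and> f ` K \<subseteq> W} | K W.
        compactin S K \<and> openin R W}"
    by blast
qed

lemma compact_neighbourhood:
  assumes "locally_compact_space X" "Hausdorff_space X" "compactin X K"
  obtains U where "openin X U" "K \<subseteq> U" "compactin X (X closure_of U)"
proof -
  obtain U L where "openin X U" "compactin X L" "closedin X L" "K \<subseteq> U" "U \<subseteq> L"
    using assms locally_compact_space_compact_closed_compact[of X] by blast
  then show thesis
    by (meson that closed_compactin closedin_closure_of closure_of_minimal)
qed

text \<open>A closed set is its interior together with its frontier, and the frontier is absorbed by
  \<open>U\<close>.\<close>

lemma openin_Un_frontier: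
  assumes "closedin X C" "openin X U" "X frontier_of C \<subseteq> U"
  shows "openin X (C \<union> U)"
proof -
  have "C \<union> U = X interior_of C \<union> U"
    using assms closure_of_closedin[OF assms(1)] interior_of_subset[of X C]
    unfolding frontier_of_def by blast
  then show ?thesis using assms by auto
qed

lemma Hausdorff_mtopology_of: "Hausdorff_space (mtopology_of m)"
  unfolding mtopology_of_def by (simp add: Metric_space.Hausdorff_space_mtopology)

lemma continuous_map_compact_image_closedin:
  assumes "continuous_map S (mtopology_of m) f" "compactin S K"
  shows "closedin (mtopology_of m) (f ` K)"
  using assms compactin_imp_closedin Hausdorff_mtopology_of image_compactin by metis

section \<open>Extending and gluing isotopies\<close>

text \<open>Here \<open>A\<close> is the support. Closedness of its image in \<open>X\<close> makes
  the complement open, so it covers \<open>X\<close> together with the image of \<open>W\<close>; by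
  \<open>const\<close> the two descriptions agree on the overlap, and by \<open>im\<close> the image
  of \<open>A\<close> is preserved, which gives bijectivity.\<close>

lemma lip_isotopy_extend_identity:
  assumes p: "open_lip_embedding V X p"
    and W: "openin (mtopology_of V) W" and A: "A \<subseteq> W" "closedin (mtopology_of X) (p ` A)"
    and k: "lip_isotopy T (submetric V W) X k"
    and im: "\<And>t. t \<in> mspace T \<Longrightarrow> k t ` A = p ` A"
    and const: "\<And>t x. t \<in> mspace T \<Longrightarrow> x \<in> W - A \<Longrightarrow> k t x = p x"
  obtains F where "lip_isotopy T X X F" "\<And>t. t \<in> mspace T \<Longrightarrow> F t ` mspace X = mspace X"
    "\<And>t x. t \<in> mspace T \<Longrightarrow> x \<in> W \<Longrightarrow> F t (p x) = k t x"
    "\<And>t y. t \<in> mspace T \<Longrightarrow> y \<in> mspace X - p ` A \<Longrightarrow> F t y = y"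
proof -
  have Ws: "W \<subseteq> mspace V" "W \<inter> mspace V = W" using openin_subset[OF W] by auto
  have As: "A \<subseteq> mspace V" using A Ws by blast
  have pinj: "inj_on p (mspace V)" by (rule open_lip_embedding_inj[OF p])
  let ?q = "inv_into (mspace V) p"
  have q: "?q (p x) = x" if "x \<in> mspace V" for x using inv_into_f_f[OF pinj that] .
  \<comment> \<open>Splitting along the image of \<open>A\<close> rather than that of
    \<open>W\<close> yields two disjoint pieces that \<open>F t\<close> preserves, so bijectivity
    can be checked on each separately.\<close>
  define F where "F t y = (if y \<in> p ` A then k t (?q y) else y)" for t y
  have FA: "F t (p x) = k t x" if "x \<in> A" for t x
    using that q[of x] As by (auto simp: F_def)
  have Fp: "F t (p x) = k t x" if t: "t \<in> mspace T" and x: "x \<in> W" for t x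
  proof (cases "x \<in> A")
    case False
    then have "p x \<notin> p ` A" using pinj As Ws x by (auto simp: inj_on_def)
    moreover have "k t x = p x" by (rule const[OF t]) (use False x in blast)
    ultimately show ?thesis by (simp add: F_def)
  qed (rule FA)
  have FpA: "F t ` (p ` A) = p ` A" if "t \<in> mspace T" for t
  proof -
    have "F t ` (p ` A) = k t ` A" unfolding image_image by (intro image_cong refl FA)
    then show ?thesis using im[OF that] by simp
  qed
  have pAX: "p ` A \<subseteq> mspace X" using closedin_subset[OF A(2)] by simp
  have Fsurj: "F t ` mspace X = mspace X" if t: "t \<in> mspace T" for t
  proof -
    have "F t ` (mspace X - p ` A) = mspace X - p ` A" by (auto simp: F_def image_iff)
    then show ?thesis using FpA[OF t] pAX by (metis Un_Diff_cancel2 image_Un sup.absorb1)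
  qed
  have Finj: "inj_on (F t) (mspace X)" if t: "t \<in> mspace T" for t
  proof -
    have "inj_on (k t) W"
      using open_lip_embedding_inj[OF lip_isotopy_slice[OF k t]] Ws by simp
    then have "inj_on (k t) A" by (rule inj_on_subset) (rule A(1))
    moreover have "(F t \<circ> p) x = k t x" if "x \<in> A" for x using FA[OF that] by simp
    ultimately have "inj_on (F t \<circ> p) A" by (simp cong: inj_on_cong)
    then have "inj_on (F t) (p ` A)" by (rule inj_on_imageI)
    moreover have "inj_on (F t) (mspace X - p ` A)" by (auto simp: F_def inj_on_def)
    moreover have "F t ` (p ` A) \<inter> F t ` (mspace X - p ` A) = {}"
      unfolding FpA[OF t] by (auto simp: F_def)
    ultimately have "inj_on (F t) (p ` A \<union> (mspace X - p ` A))"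
      unfolding inj_on_Un by blast
    then show ?thesis using pAX by (simp add: Un_absorb1)
  qed
  have pW: "openin (mtopology_of X) (p ` W)" by (rule open_lip_embedding_image[OF p W])
  have pA: "openin (mtopology_of X) (mspace X - p ` A)"
    using A(2) by (metis openin_diff openin_topspace topspace_mtopology_of)
  have pWV: "open_lip_embedding (submetric V W) X p" by (rule open_lip_embedding_submetric[OF p W])
  have idX: "open_lip_embedding X X (\<lambda>y. y)"
    unfolding open_lip_embedding_iff using lip_map_id
    by (intro conjI exI[of _ "\<lambda>y. y"]) (auto, metis openin_topspace topspace_mtopology_of)
  \<comment> \<open>The inverse of \<open>p\<close> becomes a constant isotopy by cancelling
    \<open>p\<close> from the identity on the image of \<open>W\<close>.\<close>
  have q1: "lip_isotopy T (submetric X (p ` W)) (submetric V W) (\<lambda>t y. ?q y)"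
  proof (rule lip_isotopy_cancel[OF lip_isotopy_const[OF open_lip_embedding_submetric[OF idX pW]]
        lip_isotopy_const[OF pWV]])
    fix t y assume "y \<in> mspace (submetric X (p ` W))"
    then have "y \<in> p ` W" by simp
    then obtain x where x: "x \<in> W" "y = p x" by blast
    then have "?q y = x" using q Ws(1) by blast
    then show "?q y \<in> mspace (submetric V W) \<and> p (?q y) = y" using x Ws by simp
  qed
  have "lip_isotopy T X X F"
  proof (rule lip_isotopy_glue[OF pW pA _ lip_isotopy_compose[OF q1 k]])
    show "lip_isotopy T (submetric X (mspace X - p ` A)) X (\<lambda>t y. y)"
      by (rule lip_isotopy_const[OF open_lip_embedding_submetric[OF idX pA]])
    show "mspace X \<subseteq> p ` W \<union> (mspace X - p ` A)" using A by blast
    fix t y assume "t \<in> mspace T" "y \<in> p ` W"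
    then show "F t y = k t (?q y)" using Fp q Ws by auto
  qed (use Finj in \<open>auto simp: F_def\<close>)
  then show thesis using that[of F] Fsurj Fp by (auto simp: F_def)
qed

text \<open>Both inclusions come from trapping a track \<open>{E s x | s \<in> T}\<close>: it is connected and misses
  \<open>E r ` (A - P)\<close>, which does not depend on \<open>r\<close>, so it lies in \<open>E r ` P\<close> as soon as it meets
  it.\<close>

lemma lip_isotopy_image_constant:
  assumes E: "lip_isotopy T V X E" and conn: "connected_space (mtopology_of T)"
    and b: "b \<in> mspace T" and t: "t \<in> mspace T"
    and P: "openin (mtopology_of V) P" and A: "P \<subseteq> A" "A \<subseteq> mspace V"
    and closed: "\<And>t. t \<in> mspace T \<Longrightarrow> closedin (mtopology_of X) (E t ` A)"
    and const: "\<And>t x. t \<in> mspace T \<Longrightarrow> x \<in> A - P \<Longrightarrow> E t x = E b x"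
  shows "E t ` P = E b ` P"
proof -
  have inj: "inj_on (E s) (mspace V)" if "s \<in> mspace T" for s
    using open_lip_embedding_inj[OF lip_isotopy_slice[OF E that]] .
  have EX: "E s x \<in> mspace X" if "s \<in> mspace T" "x \<in> mspace V" for s x
    using lip_isotopy_maps[OF E that] .
  have op: "openin (mtopology_of X) (E s ` P)" if "s \<in> mspace T" for s
    using open_lip_embedding_image[OF lip_isotopy_slice[OF E that] P] .
  have opA: "openin (mtopology_of X) (mspace X - E s ` A)" if "s \<in> mspace T" for s
    using closed[OF that] by (metis openin_diff openin_topspace topspace_mtopology_of)
  have disj: "E s x \<notin> E s' ` (A - P)" if "s \<in> mspace T" "s' \<in> mspace T" "x \<in> P" for s s' x
  proof
    assume "E s x \<in> E s' ` (A - P)"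
    then obtain z where z: "z \<in> A - P" "E s x = E s' z" by blast
    then have "E s x = E s z" using const that by metis
    then have "x = z" using inj[OF that(1)] that(3) z A by (meson DiffD1 inj_onD subsetD)
    then show False using z that by blast
  qed
  define Q where "Q x = (\<lambda>s. E s x) ` mspace T" for x
  have trap: "Q x \<subseteq> E r ` P"
    if x: "x \<in> P" and r: "r \<in> mspace T" and r': "r' \<in> mspace T" "E r' x \<in> E r ` P" for x r r'
  proof -
    have "continuous_map (mtopology_of T) (mtopology_of X) (\<lambda>s. E s x)"
    proof -
      have "continuous_map (mtopology_of T) (prod_topology (mtopology_of T) (mtopology_of V)) (\<lambda>s. (s, x))"
        using x A by (auto simp: continuous_map_pairwise comp_def)
      from continuous_map_compose[OF this lip_isotopy_continuous[OF E]]
      show ?thesis by (simp add: comp_def)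
    qed
    then have "connectedin (mtopology_of X) (Q x)"
      unfolding Q_def using conn connectedin_continuous_map_image connectedin_topspace
      by (metis topspace_mtopology_of)
    \<comment> \<open>Since the track avoids the image of \<open>A - P\<close>, each of its points
      outside the image of \<open>P\<close> lies outside the closed image of \<open>A\<close>. The
      two sets are open and disjoint.\<close>
    moreover have "Q x \<subseteq> E r ` P \<union> (mspace X - E r ` A)"
      unfolding Q_def
    proof (rule image_subsetI)
      fix s assume s: "s \<in> mspace T"
      have "E s x \<in> mspace X" by (rule EX[OF s]) (use x A in blast)
      moreover have "E r ` A \<subseteq> E r ` P \<union> E r ` (A - P)" by blast
      ultimately show "E s x \<in> E r ` P \<union> (mspace X - E r ` A)" using disj[OF s r x] by blast
    qed
    moreover have "separatedin (mtopology_of X) (E r ` P) (mspace X - E r ` A)"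
      using A(1) by (auto simp: separatedin_open_sets[OF op[OF r] opA[OF r]] disjnt_iff)
    ultimately have "Q x \<subseteq> E r ` P \<or> Q x \<subseteq> mspace X - E r ` A"
      by (metis connectedin_subset_separated_union)
    moreover have "E r' x \<in> Q x" using r'(1) unfolding Q_def by (rule imageI)
    moreover have "E r' x \<in> E r ` A" using r'(2) A(1) by blast
    ultimately show ?thesis by blast
  qed
  show ?thesis
  \<comment> \<open>Trapping the track in \<open>E b\<close> of \<open>P\<close> gives one
    inclusion; trapping the same track in \<open>E t\<close> of \<open>P\<close>, where it starts
    from its value at \<open>t\<close>, gives the other.\<close>
  proof (intro equalityI image_subsetI)
    fix x assume x: "x \<in> P"
    have "Q x \<subseteq> E b ` P" by (rule trap[OF x b b]) (use x in blast)
    then show "E t x \<in> E b ` P" using t unfolding Q_def by blast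
  next
    fix x assume x: "x \<in> P"
    have "Q x \<subseteq> E t ` P" by (rule trap[OF x t t]) (use x in blast)
    then show "E b x \<in> E t ` P" using b unfolding Q_def by blast
  qed
qed

section \<open>Isotopy extension\<close>

text \<open>Applies \<open>L_star\<close> to the family \<open>h t\<close> obtained by lifting
  \<open>f t\<close> through \<open>f b\<close>. The compact set \<open>M\<close> around
  \<open>U\<close> ensures that this lift exists and stays in \<open>Y\<close> for all
  \<open>t\<close> near \<open>b\<close>.\<close>

lemma L_star_isotopy:
  fixes B :: "'b metric" and V :: "'v metric" and X :: "'x metric"
  assumes L: "L_star TYPE('b) (submetric V Y)"
    and B: "locally_connected_space (mtopology_of B)" and b: "b \<in> mspace B"
    and f: "lip_isotopy B V X f"
    and Y: "openin (mtopology_of V) Y" and U: "openin (mtopology_of V) U"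
    and M: "compactin (mtopology_of V) M" and D: "compactin (mtopology_of V) D"
    and sub: "D \<subseteq> U" "U \<subseteq> M" "M \<subseteq> Y"
  obtains N \<psi> where "openin (mtopology_of B) N" "connectedin (mtopology_of B) N" "b \<in> N"
    "lip_isotopy (submetric B N) (submetric V Y) (submetric V Y) \<psi>"
    "\<And>t. t \<in> N \<Longrightarrow> \<psi> t ` Y = Y"
    "\<And>t x. t \<in> N \<Longrightarrow> x \<in> D \<Longrightarrow> f b (\<psi> t x) = f t x"
    "\<And>t x. t \<in> N \<Longrightarrow> x \<in> Y - U \<Longrightarrow> \<psi> t x = x"
    "\<And>x. x \<in> Y \<Longrightarrow> \<psi> b x = x"
proof -
  have Ys: "Y \<subseteq> mspace V" "Y \<inter> mspace V = Y" using openin_subset[OF Y] by auto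
  have Us: "U \<subseteq> mspace V" "U \<inter> mspace V = U" "Y \<inter> U = U" "U \<subseteq> Y" using openin_subset[OF U] sub by auto
  let ?Y = "submetric V Y"
  have YU: "submetric ?Y U = submetric V U" using Us by simp
  let ?S = "open_lip_embedding_space (submetric V U) ?Y"
  have UY: "openin (mtopology_of ?Y) U"
    unfolding mtopology_of_submetric using U Us by (simp add: subset_openin_subtopology)
  have DY: "compactin (mtopology_of ?Y) D"
    unfolding mtopology_of_submetric using D sub by (auto simp: compactin_subtopology)
  obtain \<N> \<Phi> where
    \<N>: "openin ?S \<N>" "restrict id U \<in> \<N>"
    and \<Phi>: "\<forall>h\<in>\<N>. lip_iso ?Y ?Y (\<Phi> h) \<and> (\<forall>x\<in>D. \<Phi> h x = h x) \<and>
             (\<forall>x\<in>mspace ?Y - U. \<Phi> h x = x)"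
    and \<Phi>id: "\<Phi> (restrict id U) = restrict id (mspace ?Y)"
    and iso: "\<forall>(Z :: 'b metric) h. lip_isotopy Z (submetric V U) ?Y h \<and> (\<forall>t\<in>mspace Z. h t \<in> \<N>) \<longrightarrow>
             lip_isotopy Z ?Y ?Y (\<lambda>t. \<Phi> (h t))"
    using L[unfolded L_star_def, THEN spec[of _ U], THEN spec[of _ D], THEN mp,
        OF conjI[OF UY conjI[OF DY sub(1)]], unfolded YU]
    by (elim exE conjE) (rule that)
  let ?p = "f b"
  have p: "open_lip_embedding V X ?p" by (rule lip_isotopy_slice[OF f b])
  have pinj: "inj_on ?p (mspace V)" by (rule open_lip_embedding_inj[OF p])
  let ?q = "inv_into (mspace V) ?p"
  have q: "?q (?p x) = x" if "x \<in> mspace V" for x using inv_into_f_f[OF pinj that] .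
  define G where "G = {q \<in> topspace (prod_topology (mtopology_of B) (mtopology_of V)). (\<lambda>(t, x). f t x) q \<in> ?p ` Y}"
  have G: "openin (prod_topology (mtopology_of B) (mtopology_of V)) G"
    unfolding G_def
    by (rule openin_continuous_map_preimage[OF lip_isotopy_continuous[OF f] open_lip_embedding_image[OF p Y]])
  \<comment> \<open>The tube lemma needs a compact fibre, so it is applied to \<open>M\<close>
    instead of the open set \<open>U\<close>.\<close>
  have "{b} \<times> M \<subseteq> G" using b sub Ys by (auto simp: G_def)
  then have "\<exists>N A. openin (mtopology_of B) N \<and> openin (mtopology_of V) A \<and> b \<in> N \<and> M \<subseteq> A \<and> N \<times> A \<subseteq> G"
    using tube_lemma_right[OF G M] b by (metis topspace_mtopology_of)
  then obtain N1 A where N1: "openin (mtopology_of B) N1" "b \<in> N1" and A: "M \<subseteq> A" "N1 \<times> A \<subseteq> G"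
    by blast
  have N1s: "N1 \<inter> mspace B = N1" using openin_subset[OF N1(1)] by auto
  \<comment> \<open>Restriction to \<open>U\<close> makes \<open>h t\<close> extensional, hence a
    point of the embedding space on which \<open>\<Phi>\<close> acts.\<close>
  define h where "h t = restrict (\<lambda>u. ?q (f t u)) U" for t
  have hext: "h t \<in> extensional U" for t unfolding h_def by (rule restrict_extensional)
  have h: "h t x \<in> Y \<and> ?p (h t x) = f t x" if "t \<in> N1" "x \<in> U" for t x
  proof -
    have "(t, x) \<in> G" using A that sub(2) by blast
    then obtain y where y: "y \<in> Y" "f t x = ?p y" by (auto simp: G_def)
    have "h t x = y" using q[of y] y Ys(1) that(2) by (auto simp: h_def)
    then show ?thesis using y by simp
  qed
  let ?T = "submetric B N1"
  have fT: "lip_isotopy ?T V X f" by (rule lip_isotopy_base[OF f N1(1)])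
  have hiso: "lip_isotopy ?T (submetric V U) ?Y h"
    by (rule lip_isotopy_cancel[OF lip_isotopy_submetric[OF fT U]
          lip_isotopy_const[OF open_lip_embedding_submetric[OF p Y]]]) (use h Ys in auto)
  \<comment> \<open>Joint continuity makes \<open>t \<mapsto> h t\<close> continuous into the
    embedding space, so the parameters with \<open>h t \<in> \<N>\<close> form an open set; it
    contains \<open>b\<close> because \<open>h b\<close> is the inclusion.\<close>
  have "continuous_map (mtopology_of ?T) (compact_open_topology (mtopology_of (submetric V U)) (mtopology_of ?Y)) h"
    by (rule continuous_map_compact_open_topology[OF lip_isotopy_continuous[OF hiso]])
      (simp add: hext Us)
  then have "continuous_map (mtopology_of ?T) ?S h"
    unfolding open_lip_embedding_space_def continuous_map_in_subtopology
    using lip_isotopy_slice[OF hiso] by (auto simp: hext Us)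
  from openin_continuous_map_preimage[OF this \<N>(1)]
  have "openin (subtopology (mtopology_of B) N1) {t \<in> N1. h t \<in> \<N>}"
    unfolding topspace_mtopology_of mspace_submetric N1s
    unfolding mtopology_of_submetric .
  then have "openin (mtopology_of B) {t \<in> N1. h t \<in> \<N>}"
    using N1(1) by (rule openin_trans_full)
  moreover have hb: "h b = restrict id U"
    unfolding h_def by (rule restrict_ext) (use q Us in auto)
  then have "b \<in> {t \<in> N1. h t \<in> \<N>}" using \<N>(2) N1(2) by simp
  \<comment> \<open>Local connectedness of \<open>B\<close> enters here: a connected parameter set
    is what later keeps tracks from jumping across the collar.\<close>
  ultimately have "\<exists>N. openin (mtopology_of B) N \<and> connectedin (mtopology_of B) N \<and> b \<in> N \<and>
      N \<subseteq> {t \<in> N1. h t \<in> \<N>}"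
    by (intro B[unfolded locally_connected_space, rule_format] conjI)
  then obtain N where N: "openin (mtopology_of B) N" "connectedin (mtopology_of B) N" "b \<in> N"
    and NN: "N \<subseteq> {t \<in> N1. h t \<in> \<N>}"
    by (elim exE conjE) (rule that)
  have "N1 \<inter> N = N" using NN by blast
  then have "submetric ?T N = submetric B N" by simp
  moreover have "openin (mtopology_of ?T) N"
    unfolding mtopology_of_submetric using N(1) NN by (simp add: subset_openin_subtopology subset_iff)
  ultimately have "lip_isotopy (submetric B N) (submetric V U) ?Y h"
    using lip_isotopy_base[OF hiso] by metis
  \<comment> \<open>Property (P) is used with \<open>N\<close> as the parameter space, whose points
    have the type of those of \<open>B\<close>.\<close>
  then have \<psi>: "lip_isotopy (submetric B N) ?Y ?Y (\<lambda>t. \<Phi> (h t))"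
    using NN by (intro iso[rule_format]) auto
  show thesis
  proof (rule that[OF N \<psi>])
    fix t assume "t \<in> N"
    then have t: "t \<in> N1" "h t \<in> \<N>" using NN by auto
    show "\<Phi> (h t) ` Y = Y"
      using bspec[OF \<Phi> t(2)] Ys unfolding lip_iso_def bij_betw_def by auto
    show "?p (\<Phi> (h t) x) = f t x" if "x \<in> D" for x
      using bspec[OF \<Phi> t(2)] h[OF t(1), of x] that sub(1) by auto
    show "\<Phi> (h t) x = x" if "x \<in> Y - U" for x
      using bspec[OF \<Phi> t(2)] that Ys by auto
  next
    show "\<Phi> (h b) x = x" if "x \<in> Y" for x
      unfolding hb \<Phi>id using that Ys by auto
  qed
qed

theorem corollary4p6:
  fixes B :: "'b metric" and X :: "'x metric" and V :: "'v metric"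
    and f :: "'b \<Rightarrow> 'v \<Rightarrow> 'x" and C :: "'v set" and b :: 'b
  assumes "locally_connected_space (mtopology_of B)"
    and "locally_compact_space (mtopology_of X)"
    and "locally_connected_space (mtopology_of X)"
    and "\<And>t. t \<in> mspace B \<Longrightarrow> open_lip_embedding V X (f t)"
    and "lip_isotopy B V X f"
    and "closedin (mtopology_of V) C"
    and "compactin (mtopology_of V) (mtopology_of V frontier_of C)"
    and "\<And>t. t \<in> mspace B \<Longrightarrow> closedin (mtopology_of X) (f t ` C)"
    and "L_star TYPE('b) (submetric V (mspace V - C))"
    and "b \<in> mspace B"
  shows "\<exists>N F. nhd_of (mtopology_of B) {b} N \<and>
           (\<forall>t\<in>N. lip_iso X X (F t)) \<and>
           lip_isotopy (submetric B N) X X F \<and>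
           (\<exists>W. nhd_of (mtopology_of V) C W \<and>
              (\<forall>t\<in>N. \<forall>x\<in>W. F t (f b x) = f t x)) \<and>
           (compactin (mtopology_of V) C \<longrightarrow>
              (\<exists>K. nhd_of (mtopology_of V) C K \<and> compactin (mtopology_of V) K \<and>
                 (\<forall>t\<in>N. \<forall>x\<in>mspace V - K. F t (f b x) = f b x)))"
proof -
  let ?V = "mtopology_of V" and ?p = "f b" and ?Y = "mspace V - C"
  have p: "open_lip_embedding V X ?p" and pC: "closedin (mtopology_of X) (?p ` C)"
    using assms(4,8,10) by auto
  have pinj: "inj_on ?p (mspace V)" by (rule open_lip_embedding_inj[OF p])
  have haus: "Hausdorff_space ?V" by (rule Hausdorff_mtopology_of)
  \<comment> \<open>An open subset of the locally compact Hausdorff space \<open>X\<close> is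
    locally compact, and \<open>f b\<close> identifies \<open>V\<close> with such a subset.\<close>
  have "locally_compact_space (subtopology (mtopology_of X) (?p ` mspace V))"
    using locally_compact_space_open_subset[OF disjI1[OF Hausdorff_mtopology_of] assms(2)] p
    unfolding open_lip_embedding_iff by blast
  then have lc: "locally_compact_space ?V"
    using homeomorphic_locally_compact_space[OF open_lip_embedding_homeomorphic[OF p]] by simp
  have C: "C \<subseteq> mspace V" using closedin_subset[OF assms(6)] by simp
  have Y: "openin ?V ?Y" using assms(6) by (metis openin_diff openin_topspace topspace_mtopology_of)
  \<comment> \<open>\<open>P\<close>, \<open>A\<close>, \<open>P'\<close> are nested neighbourhoods of \<open>C\<close>; \<open>D\<close> contains the collar \<open>P' - P\<close>
    on which the isotopy gets corrected, and the correction is supported in \<open>U\<close>.\<close>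
  obtain O0 where O0: "openin ?V O0" "?V frontier_of C \<subseteq> O0" "compactin ?V (?V closure_of O0)"
    using compact_neighbourhood[OF lc haus assms(7)] by blast
  obtain O1 where O1: "openin ?V O1" "?V closure_of O0 \<subseteq> O1" "compactin ?V (?V closure_of O1)"
    using compact_neighbourhood[OF lc haus O0(3)] by blast
  obtain O2 where O2: "openin ?V O2" "?V closure_of O1 \<subseteq> O2" "compactin ?V (?V closure_of O2)"
    using compact_neighbourhood[OF lc haus O1(3)] by blast
  obtain O3 where O3: "openin ?V O3" "?V closure_of O2 \<subseteq> O3" "compactin ?V (?V closure_of O3)"
    using compact_neighbourhood[OF lc haus O2(3)] by blast
  have cl: "O0 \<subseteq> ?V closure_of O0" "O1 \<subseteq> ?V closure_of O1" "O2 \<subseteq> ?V closure_of O2" "O3 \<subseteq> ?V closure_of O3"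
    by (rule closure_of_subset[OF openin_subset], fact)+
  have fr: "?V frontier_of C \<subseteq> O0" "?V frontier_of C \<subseteq> O1" "?V frontier_of C \<subseteq> O2"
    using O0(2) O1(2) O2(2) cl by blast+
  define P where "P = C \<union> O1"
  define A where "A = C \<union> ?V closure_of O1"
  define P' where "P' = C \<union> O2"
  define U where "U = O3 - (C \<union> ?V closure_of O0)"
  define D where "D = ?V closure_of O2 - P"
  define M where "M = ?V closure_of O3 - (C \<union> O0)"
  \<comment> \<open>Each of the sets \<open>O0\<close>, \<open>O1\<close>, \<open>O2\<close>
    contains the frontier of \<open>C\<close>, so adjoining it to \<open>C\<close> gives an open
    set. For this reason removing \<open>C \<union> O0\<close> or \<open>P\<close> from a compact
    closure leaves the compact sets \<open>M\<close> and \<open>D\<close>.\<close>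
  have opn: "openin ?V (C \<union> O0)" "openin ?V P" "openin ?V P'"
    unfolding P_def P'_def
    using openin_Un_frontier[OF assms(6) O0(1)] openin_Un_frontier[OF assms(6) O1(1)]
      openin_Un_frontier[OF assms(6) O2(1)] fr by blast+
  have U: "openin ?V U" unfolding U_def using O3(1) assms(6) by (intro openin_diff closedin_Un) auto
  have compact_diff: "compactin ?V (?V closure_of O' - Q)"
    if "compactin ?V (?V closure_of O')" "openin ?V Q" for O' Q
    by (rule closed_compactin[OF that(1) Diff_subset]) (intro closedin_diff closedin_closure_of that(2))
  have D: "compactin ?V D" and M: "compactin ?V M"
    unfolding D_def M_def using compact_diff opn O2(3) O3(3) by auto
  have DU: "D \<subseteq> U" unfolding D_def U_def P_def using O1(2) O3(2) by blast
  have UM: "U \<subseteq> M" unfolding U_def M_def using cl by blast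
  have MY: "M \<subseteq> ?Y" unfolding M_def using closure_of_subset_topspace[of ?V O3] by auto
  have PA: "P \<subseteq> A" "A \<subseteq> P'" unfolding P_def A_def P'_def using cl O2(2) by auto
  have P'D: "P' - P \<subseteq> D" unfolding D_def P'_def P_def using cl by blast
  have AV: "A \<subseteq> mspace V" using PA(2) openin_subset[OF opn(3)] by auto
  obtain N \<psi> where N: "openin (mtopology_of B) N" "connectedin (mtopology_of B) N" "b \<in> N"
    and \<psi>: "lip_isotopy (submetric B N) (submetric V ?Y) (submetric V ?Y) \<psi>"
    and \<psi>surj: "\<And>t. t \<in> N \<Longrightarrow> \<psi> t ` ?Y = ?Y"
    and \<psi>D: "\<And>t x. t \<in> N \<Longrightarrow> x \<in> D \<Longrightarrow> ?p (\<psi> t x) = f t x"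
    and \<psi>U: "\<And>t x. t \<in> N \<Longrightarrow> x \<in> ?Y - U \<Longrightarrow> \<psi> t x = x"
    and \<psi>b: "\<And>x. x \<in> ?Y \<Longrightarrow> \<psi> b x = x"
    by (rule L_star_isotopy[OF assms(9,1,10,5) Y U M D DU UM MY]) blast
  let ?T = "submetric B N"
  have NB: "N \<subseteq> mspace B" using openin_subset[OF N(1)] by simp
  then have TN: "mspace ?T = N" by auto
  have bT: "b \<in> mspace ?T" using N(3) TN by simp
  have fT: "lip_isotopy ?T V X f" by (rule lip_isotopy_base[OF assms(5) N(1)])
  \<comment> \<open>A bijection of \<open>V - C\<close> that fixes every point outside
    \<open>M\<close> maps \<open>M\<close> onto itself.\<close>
  have \<psi>M: "\<psi> t ` M = M" if t: "t \<in> N" for t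
  proof -
    have stays: "\<psi> t x = x" if "x \<in> ?Y - M" for x using \<psi>U[OF t, of x] that UM by blast
    have "inj_on (\<psi> t) ?Y"
      using open_lip_embedding_inj[OF lip_isotopy_slice[OF \<psi>, of t]] t NB
      by (auto simp: Int_absorb2)
    then have "\<psi> t ` M = \<psi> t ` ?Y - \<psi> t ` (?Y - M)"
      using MY by (simp add: inj_on_image_set_diff[symmetric] double_diff)
    also have "\<psi> t ` (?Y - M) = ?Y - M" using stays by simp
    finally show ?thesis using \<psi>surj[OF t] MY by (simp add: double_diff)
  qed
  \<comment> \<open>The family \<open>\<psi>\<close> is carried to \<open>X\<close> by
    \<open>?p\<close> and extended by the identity; its support \<open>M\<close> has closed image
    because it is compact.\<close>
  obtain G where G: "lip_isotopy ?T X X G"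
    and Gsurj: "\<And>t. t \<in> N \<Longrightarrow> G t ` mspace X = mspace X"
    and Gp: "\<And>t x. t \<in> N \<Longrightarrow> x \<in> ?Y \<Longrightarrow> G t (?p x) = ?p (\<psi> t x)"
    and Gid: "\<And>t y. t \<in> N \<Longrightarrow> y \<in> mspace X - ?p ` M \<Longrightarrow> G t y = y"
  proof (rule lip_isotopy_extend_identity[OF p Y MY])
    show "closedin (mtopology_of X) (?p ` M)"
      by (rule continuous_map_compact_image_closedin[OF open_lip_embedding_continuous[OF p] M])
    show "lip_isotopy ?T (submetric V ?Y) X (\<lambda>t x. ?p (\<psi> t x))"
      by (rule lip_isotopy_compose[OF \<psi> lip_isotopy_const[OF open_lip_embedding_submetric[OF p Y]]])
    show "(\<lambda>x. ?p (\<psi> t x)) ` M = ?p ` M" if "t \<in> mspace ?T" for t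
      using \<psi>M[of t] that TN by (metis image_image)
    show "?p (\<psi> t x) = ?p x" if "t \<in> mspace ?T" "x \<in> ?Y - M" for t x
    proof -
      have "\<psi> t x = x" by (rule \<psi>U) (use that TN UM in blast)+
      then show ?thesis by simp
    qed
  qed (unfold TN, rule that, assumption, blast+)
  have Ginj: "inj_on (G t) (mspace X)" if "t \<in> N" for t
    using open_lip_embedding_inj[OF lip_isotopy_slice[OF G]] that TN by blast
  have fX: "f t x \<in> mspace X" if "t \<in> N" "x \<in> mspace V" for t x
    using lip_isotopy_maps[OF fT] that TN by blast
  define E where "E t x = inv_into (mspace X) (G t) (f t x)" for t x
  have E: "E t x \<in> mspace X \<and> G t (E t x) = f t x" if "t \<in> N" "x \<in> mspace V" for t x
    unfolding E_def using fX[OF that] Gsurj[OF that(1)] by (metis f_inv_into_f inv_into_into)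
  have E_eq: "E t x = y" if "t \<in> N" "y \<in> mspace X" "G t y = f t x" for t x y
    unfolding E_def using that Ginj by (metis inv_into_f_f)
  \<comment> \<open>\<open>E\<close> is defined by inverting each \<open>G t\<close> separately;
    cancelling the isotopy \<open>G\<close> from \<open>f\<close> gives the Lipschitz dependence on
    the parameter.\<close>
  have Eiso: "lip_isotopy ?T V X E"
    by (rule lip_isotopy_cancel[OF fT G]) (use E TN in auto)
  \<comment> \<open>On \<open>D\<close> the map \<open>G t\<close> already carries \<open>?p\<close>
    to \<open>f t\<close>, so removing \<open>G t\<close> from \<open>f t\<close> leaves
    \<open>?p\<close>.\<close>
  have ED: "E t x = ?p x" if "t \<in> N" "x \<in> D" for t x
  proof (rule E_eq[OF that(1)])
    have "x \<in> ?Y" using that DU UM MY by blast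
    then show "?p x \<in> mspace X" "G t (?p x) = f t x"
      using fX[OF N(3)] Gp[OF that(1)] \<psi>D[OF that] by auto
  qed
  \<comment> \<open>It suffices that \<open>G b\<close> fixes the image of \<open>?p\<close>: on
    \<open>V - C\<close> because \<open>\<psi> b\<close> is the identity, on \<open>C\<close>
    because its image lies outside that of \<open>M\<close>.\<close>
  have Eb: "E b x = ?p x" if "x \<in> mspace V" for x
  proof (rule E_eq[OF N(3) fX[OF N(3) that]])
    show "G b (?p x) = ?p x"
    proof (cases "x \<in> ?Y")
      case False
      then have "?p x \<notin> ?p ` M" using MY that pinj C by (auto simp: inj_on_def)
      then show ?thesis using Gid[OF N(3)] fX[OF N(3) that] by blast
    qed (use Gp[OF N(3)] \<psi>b in auto)
  qed
  \<comment> \<open>The image of \<open>A\<close> is the union of the image of \<open>C\<close>,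
    closed by hypothesis, and the image of a compact set.\<close>
  have fA: "closedin (mtopology_of X) (f t ` A)" if "t \<in> N" for t
  proof -
    have "t \<in> mspace B" using that NB by blast
    then show ?thesis unfolding A_def image_Un
      using assms(8) continuous_map_compact_image_closedin[OF open_lip_embedding_continuous[OF assms(4)] O1(3)]
      by (intro closedin_Un) auto
  qed
  have closed: "closedin (mtopology_of X) (E t ` A)" if "t \<in> N" for t
  proof -
    \<comment> \<open>The image of \<open>A\<close> under \<open>E t\<close> is the preimage under
      the continuous \<open>G t\<close> of the closed image under \<open>f t\<close>.\<close>
    have "E t ` A = {y \<in> topspace (mtopology_of X). G t y \<in> f t ` A}"
      using E[OF that] E_eq[OF that] AV by (auto simp: image_iff subset_iff)
    moreover have "continuous_map (mtopology_of X) (mtopology_of X) (G t)"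
      using open_lip_embedding_continuous[OF lip_isotopy_slice[OF G]] that TN by blast
    ultimately show ?thesis using closedin_continuous_map_preimage fA[OF that] by metis
  qed
  have conn: "connected_space (mtopology_of ?T)"
    using N(2) unfolding mtopology_of_submetric connectedin_def by blast
  have P'V: "P' \<subseteq> mspace V" using openin_subset[OF opn(3)] by simp
  have const: "E t x = ?p x" if "t \<in> N" "x \<in> P' - P" for t x
    using ED[OF that(1)] that P'D by blast
  have Ebim: "E b ` S = ?p ` S" if "S \<subseteq> mspace V" for S
    using Eb that by (intro image_cong) auto
  have pA: "closedin (mtopology_of X) (?p ` A)"
    using closed[OF N(3)] Ebim[OF AV] by simp
  \<comment> \<open>On \<open>P\<close> the image stays constant by connectedness of
    \<open>N\<close>; on the rest of \<open>A\<close>, which lies in the collar, \<open>E t\<close>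
    and \<open>?p\<close> agree pointwise.\<close>
  have EA: "E t ` A = ?p ` A" if t: "t \<in> N" for t
  proof -
    have eq: "E t x = ?p x" if "x \<in> A - P" for x
      using const[OF t] that PA by blast
    have "E t ` P = E b ` P"
    proof (rule lip_isotopy_image_constant[OF Eiso conn bT _ opn(2) PA(1) AV])
      show "E s x = E b x" if "s \<in> mspace ?T" "x \<in> A - P" for s x
      proof -
        have "x \<in> P' - P" "s \<in> N" using that TN PA by blast+
        then show ?thesis using const[of s x] const[OF N(3), of x] by simp
      qed
    qed (use t closed TN in auto)
    also have "\<dots> = ?p ` P" using PA AV by (intro Ebim) blast
    moreover have "E t ` (A - P) = ?p ` (A - P)" using eq by simp
    ultimately show ?thesis using PA(1) by (metis Diff_partition image_Un)
  qed
  \<comment> \<open>The support is now \<open>A\<close> inside the open set \<open>P'\<close>; the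
    gap \<open>P' - A\<close> belongs to the collar, where \<open>E t\<close> is already
    \<open>?p\<close>, and so supplies the overlap for gluing with the identity.\<close>
  obtain H where H: "lip_isotopy ?T X X H"
    and Hsurj: "\<And>t. t \<in> N \<Longrightarrow> H t ` mspace X = mspace X"
    and HP': "\<And>t x. t \<in> N \<Longrightarrow> x \<in> P' \<Longrightarrow> H t (?p x) = E t x"
    and Hid: "\<And>t y. t \<in> N \<Longrightarrow> y \<in> mspace X - ?p ` A \<Longrightarrow> H t y = y"
  proof (rule lip_isotopy_extend_identity[OF p opn(3) PA(2) pA lip_isotopy_submetric[OF Eiso opn(3)]])
    show "E t ` A = ?p ` A" if "t \<in> mspace ?T" for t
      using EA that TN by blast
    show "E t x = ?p x" if "t \<in> mspace ?T" "x \<in> P' - A" for t x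
      by (rule const) (use that TN PA in blast)+
  qed (unfold TN, rule that, assumption, blast+)
  define F where "F t y = G t (H t y)" for t y
  have F: "lip_isotopy ?T X X F"
    unfolding F_def by (rule lip_isotopy_compose[OF H G])
  have Fiso: "lip_iso X X (F t)" if "t \<in> N" for t
  proof (rule open_lip_embedding_imp_lip_iso)
    show "open_lip_embedding X X (F t)" using lip_isotopy_slice[OF F] that TN by blast
    have "F t ` mspace X = G t ` (H t ` mspace X)" unfolding F_def image_image ..
    then show "F t ` mspace X = mspace X" using Hsurj Gsurj that by simp
  qed
  \<comment> \<open>On the image of \<open>P'\<close> the map \<open>H t\<close> produces
    \<open>E t\<close>, and \<open>G t\<close> turns \<open>E t\<close> back into
    \<open>f t\<close>.\<close>
  have Fp: "F t (?p x) = f t x" if "t \<in> N" "x \<in> P'" for t x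
  proof -
    have x: "x \<in> mspace V" using that(2) P'V by blast
    then show ?thesis unfolding F_def using HP'[OF that] E[OF that(1) x] by simp
  qed
  \<comment> \<open>This set contains both \<open>A\<close> and \<open>M\<close>, the supports of
    \<open>H\<close> and \<open>G\<close> seen in \<open>V\<close>, so outside it neither factor
    moves the image point. It is compact whenever \<open>C\<close> is.\<close>
  let ?K = "C \<union> ?V closure_of O3"
  have Fout: "F t (?p x) = ?p x" if "t \<in> N" "x \<in> mspace V - ?K" for t x
  proof -
    have x: "x \<in> mspace V" "x \<notin> A" "x \<notin> M"
      using that cl O2(2) O3(2) unfolding A_def M_def by blast+
    have "M \<subseteq> mspace V" using MY by blast
    then have "?p x \<notin> ?p ` A" "?p x \<notin> ?p ` M"
      using x inj_on_image_mem_iff[OF pinj x(1)] AV by blast+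
    then show ?thesis
      unfolding F_def using Hid[OF that(1)] Gid[OF that(1)] fX[OF N(3) x(1)] by simp
  qed
  have "nhd_of (mtopology_of B) {b} N"
    unfolding nhd_of_def using N NB by (simp add: interior_of_openin)
  moreover have "nhd_of ?V C P'"
    unfolding nhd_of_def using opn(3) P'V by (auto simp: interior_of_openin P'_def)
  moreover have "nhd_of ?V C ?K"
  proof -
    have "P' \<subseteq> ?V interior_of ?K"
      by (rule interior_of_maximal[OF _ opn(3)]) (use cl O3(2) in \<open>unfold P'_def, blast\<close>)
    then show ?thesis unfolding nhd_of_def
      using C closure_of_subset_topspace[of ?V O3] by (auto simp: P'_def)
  qed
  moreover have "compactin ?V ?K" if "compactin ?V C" using that O3(3) by (rule compactin_Un)
  ultimately show ?thesis using F Fiso Fp Fout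
    by (intro exI[of _ N] exI[of _ F]) blast
qed

end
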